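(* Let $X$ be a shift space, let $Y$ be a shift of finite type, and let $\phi:X\to Y$ be a finite-to-one factor code. Suppose that either every proper subsystem $Z$ of $X$ satisfies $h(Z)<h(X)$, or $\phi$ is irreducible. If $\phi$ is bi-continuing a.e. with a bi-retract, then $\phi$ is open with a uniform lifting length.
   Context: Shift spaces are closed (hence compact) shift-invariant subsets of full shifts over finite alphabets; a subsystem of $X$ is a shift space contained in $X$; $h$ denotes topological entropy, $h(X)=\lim_{n}\frac1n\log|\mathcal B_n(X)|$ with $\mathcal B_n(X)$ the set of words of length $n$ occurring in $X$. A code is a sliding block code (continuous shift-commuting map); a factor code is an onto code; it is finite-to-one if every point has finitely many preimages. A map $\phi:X\to Y$ is irreducible if the only closed $A\subseteq X$ with $\phi(A)=\phi(X)$ is $A=X$. A point $x\in X$ is left transitive (resp. right transitive) if every block occurring in $X$ appears in $x$ infinitely often to the left (resp. to the right). Two points are left asymptotic (resp. right asymptotic) if their coordinates agree on some $(-\infty,N]$ (resp. $[N,\infty)$). A code $\phi:X\to Y$ is right-continuing a.e. if whenever $x\in X$ is left transitive and $\phi(x)$ is left asymptotic to $y\in Y$, there is $\overline x\in X$ left asymptotic to $x$ with $\phi(\overline x)=y$. Left-continuing a.e. is defined symmetrically (with $x$ right transitive and right asymptoticity); bi-continuing a.e. means both. An integer $n\ge 0$ is a right-continuing a.e. retract of $\phi$ if whenever $x\in X$ is left transitive, $y\in Y$ and $\phi(x)_{(-\infty,0]}=y_{(-\infty,0]}$, there is $\overline x\in X$ with $\phi(\overline x)=y$ and $\overline x_{(-\infty,-n]}=x_{(-\infty,-n]}$.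 Left-continuing a.e. retracts are defined symmetrically. $\phi$ is bi-continuing a.e. with a bi-retract if some integer $n\geq 0$ is both a right- and a left-continuing a.e. retract. A code $\phi:X\to Y$ is open if images of open sets are open; equivalently, for each $l\in\mathbb N$ there is $k\in\mathbb N$ such that whenever $x\in X$, $y\in Y$ and $\phi(x)_{[-k,k]}=y_{[-k,k]}$, there is $\overline x\in X$ with $\overline x_{[-l,l]}=x_{[-l,l]}$ and $\phi(\overline x)=y$. It is open with a uniform lifting length if for each $l$ such a $k=k(l)$ can be chosen with $\sup_l|k(l)-l|<\infty$.
   Formalization: In the case where φ is irreducible, the shift space X is also assumed irreducible (topologically transitive); without this, X may have no transitive points, the continuing a.e. hypothesis is vacuous, and the claim fails. *)

theory Defs
  imports "HOL-Analysis.Analysis"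
begin

definition full_shift :: "'a set \<Rightarrow> (int \<Rightarrow> 'a) set" where
  "full_shift A = {x. range x \<subseteq> A}"

text \<open>The subspace topology on a set of bi-infinite sequences, inherited from the product of
  discrete spaces. It does not depend on the choice of an alphabet containing all symbols used.\<close>

definition seq_top :: "(int \<Rightarrow> 'a) set \<Rightarrow> (int \<Rightarrow> 'a) topology" where
  "seq_top X = subtopology (product_topology (\<lambda>_. discrete_topology UNIV) UNIV) X"

definition shift_map :: "(int \<Rightarrow> 'a) \<Rightarrow> int \<Rightarrow> 'a" where
  "shift_map x = (\<lambda>i. x (i + 1))"

definition shift_space :: "(int \<Rightarrow> 'a) set \<Rightarrow> bool" where
  "shift_space X \<longleftrightarrow>
     (\<exists>A. finite A \<and> closedin (seq_top (full_shift A)) X) \<and> shift_map ` X = X"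

definition subsystem :: "(int \<Rightarrow> 'a) set \<Rightarrow> (int \<Rightarrow> 'a) set \<Rightarrow> bool" where
  "subsystem Z X \<longleftrightarrow> shift_space Z \<and> Z \<subseteq> X"

definition occurs_at :: "'a list \<Rightarrow> (int \<Rightarrow> 'a) \<Rightarrow> int \<Rightarrow> bool" where
  "occurs_at w x i \<longleftrightarrow> (\<forall>j<length w. x (i + int j) = w ! j)"

definition language :: "(int \<Rightarrow> 'a) set \<Rightarrow> 'a list set" where
  "language X = {w. \<exists>x\<in>X. \<exists>i. occurs_at w x i}"

definition words :: "(int \<Rightarrow> 'a) set \<Rightarrow> nat \<Rightarrow> 'a list set" where
  "words X n = {w \<in> language X. length w = n}"

definition shift_of_finite_type :: "(int \<Rightarrow> 'a) set \<Rightarrow> bool" where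
  "shift_of_finite_type X \<longleftrightarrow>
     (\<exists>A F. finite A \<and> finite F \<and>
        X = {x \<in> full_shift A. \<forall>w\<in>F. \<forall>i. \<not> occurs_at w x i})"

text \<open>The empty shift gets entropy \<open>-\<infinity>\<close>, i.e. log 0 is read as \<open>-\<infinity>\<close>; HOL's convention
  \<open>ln 0 = 0\<close> would otherwise give it the entropy of a periodic orbit.\<close>

definition entropy :: "(int \<Rightarrow> 'a) set \<Rightarrow> ereal" where
  "entropy X = (if X = {} then -\<infinity>
     else ereal (lim (\<lambda>n. ln (real (card (words X n))) / real n)))"

text \<open>A map between shift spaces is a total function of which only the values on \<open>X\<close> matter.\<close>

definition code :: "(int \<Rightarrow> 'a) set \<Rightarrow> (int \<Rightarrow> 'b) set \<Rightarrow> ((int \<Rightarrow> 'a) \<Rightarrow> int \<Rightarrow> 'b) \<Rightarrow> bool" where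
  "code X Y \<phi> \<longleftrightarrow> continuous_map (seq_top X) (seq_top Y) \<phi> \<and>
     (\<forall>x\<in>X. \<phi> (shift_map x) = shift_map (\<phi> x))"

definition factor_code ::
  "(int \<Rightarrow> 'a) set \<Rightarrow> (int \<Rightarrow> 'b) set \<Rightarrow> ((int \<Rightarrow> 'a) \<Rightarrow> int \<Rightarrow> 'b) \<Rightarrow> bool" where
  "factor_code X Y \<phi> \<longleftrightarrow> code X Y \<phi> \<and> \<phi> ` X = Y"

definition finite_to_one ::
  "(int \<Rightarrow> 'a) set \<Rightarrow> (int \<Rightarrow> 'b) set \<Rightarrow> ((int \<Rightarrow> 'a) \<Rightarrow> int \<Rightarrow> 'b) \<Rightarrow> bool" where
  "finite_to_one X Y \<phi> \<longleftrightarrow> (\<forall>y\<in>Y. finite {x\<in>X. \<phi> x = y})"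

text \<open>The competing sets \<open>C\<close> are closed but need not be shift-invariant.\<close>

definition irreducible_map :: "(int \<Rightarrow> 'a) set \<Rightarrow> ((int \<Rightarrow> 'a) \<Rightarrow> int \<Rightarrow> 'b) \<Rightarrow> bool" where
  "irreducible_map X \<phi> \<longleftrightarrow> (\<forall>C. closedin (seq_top X) C \<and> \<phi> ` C = \<phi> ` X \<longrightarrow> C = X)"

text \<open>Irreducibility (topological transitivity) of the shift space itself. It is used only with
  irreducible maps, where "continuing a.e." says nothing if \<open>X\<close> has no transitive points: take for
  \<open>X\<close> the orbits of \<open>(01)\<^sup>\<infinity>.2\<^sup>\<infinity>\<close>, \<open>(01)\<^sup>\<infinity>\<close> and \<open>2\<^sup>\<infinity>\<close>, and let \<open>\<phi>\<close> map 0, 1 to 0 and 2 to 1. Then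
  \<open>\<phi>\<close> is an irreducible finite-to-one factor code onto the shift of finite type forbidding the word
  10, every retract condition holds vacuously, and \<open>\<phi>\<close> is not open. If all proper subsystems have
  smaller entropy, then \<open>X\<close> is automatically irreducible.\<close>

definition irreducible_shift :: "(int \<Rightarrow> 'a) set \<Rightarrow> bool" where
  "irreducible_shift X \<longleftrightarrow>
     (\<forall>u\<in>language X. \<forall>v\<in>language X. \<exists>w. u @ w @ v \<in> language X)"

definition left_transitive :: "(int \<Rightarrow> 'a) set \<Rightarrow> (int \<Rightarrow> 'a) \<Rightarrow> bool" where
  "left_transitive X x \<longleftrightarrow> x \<in> X \<and> (\<forall>w\<in>language X. infinite {i. i \<le> 0 \<and> occurs_at w x i})"

definition right_transitive :: "(int \<Rightarrow> 'a) set \<Rightarrow> (int \<Rightarrow> 'a) \<Rightarrow> bool" where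
  "right_transitive X x \<longleftrightarrow> x \<in> X \<and> (\<forall>w\<in>language X. infinite {i. 0 \<le> i \<and> occurs_at w x i})"

definition right_continuing_ae_retract ::
  "(int \<Rightarrow> 'a) set \<Rightarrow> (int \<Rightarrow> 'b) set \<Rightarrow> ((int \<Rightarrow> 'a) \<Rightarrow> int \<Rightarrow> 'b) \<Rightarrow> nat \<Rightarrow> bool" where
  "right_continuing_ae_retract X Y \<phi> n \<longleftrightarrow>
     (\<forall>x y. left_transitive X x \<and> y \<in> Y \<and> (\<forall>i\<le>0. \<phi> x i = y i) \<longrightarrow>
        (\<exists>x'\<in>X. \<phi> x' = y \<and> (\<forall>i\<le>- int n. x' i = x i)))"

definition left_continuing_ae_retract ::
  "(int \<Rightarrow> 'a) set \<Rightarrow> (int \<Rightarrow> 'b) set \<Rightarrow> ((int \<Rightarrow> 'a) \<Rightarrow> int \<Rightarrow> 'b) \<Rightarrow> nat \<Rightarrow> bool" where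
  "left_continuing_ae_retract X Y \<phi> n \<longleftrightarrow>
     (\<forall>x y. right_transitive X x \<and> y \<in> Y \<and> (\<forall>i\<ge>0. \<phi> x i = y i) \<longrightarrow>
        (\<exists>x'\<in>X. \<phi> x' = y \<and> (\<forall>i\<ge>int n. x' i = x i)))"

text \<open>A retract forces the code to be continuing a.e.: shift both points so that the coordinate
  up to which the images agree becomes 0. So this needs no separate continuing condition.\<close>

definition bi_continuing_ae_with_bi_retract ::
  "(int \<Rightarrow> 'a) set \<Rightarrow> (int \<Rightarrow> 'b) set \<Rightarrow> ((int \<Rightarrow> 'a) \<Rightarrow> int \<Rightarrow> 'b) \<Rightarrow> bool" where
  "bi_continuing_ae_with_bi_retract X Y \<phi> \<longleftrightarrow>
     (\<exists>n. right_continuing_ae_retract X Y \<phi> n \<and> left_continuing_ae_retract X Y \<phi> n)"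

text \<open>\<open>k\<close> is admissible for \<open>l\<close> in the block formulation of openness.\<close>

definition lifting_length ::
  "(int \<Rightarrow> 'a) set \<Rightarrow> (int \<Rightarrow> 'b) set \<Rightarrow> ((int \<Rightarrow> 'a) \<Rightarrow> int \<Rightarrow> 'b) \<Rightarrow> nat \<Rightarrow> nat \<Rightarrow> bool" where
  "lifting_length X Y \<phi> l k \<longleftrightarrow>
     (\<forall>x\<in>X. \<forall>y\<in>Y. (\<forall>i\<in>{- int k..int k}. \<phi> x i = y i) \<longrightarrow>
        (\<exists>x'\<in>X. (\<forall>i\<in>{- int l..int l}. x' i = x i) \<and> \<phi> x' = y))"

definition open_with_uniform_lifting_length ::
  "(int \<Rightarrow> 'a) set \<Rightarrow> (int \<Rightarrow> 'b) set \<Rightarrow> ((int \<Rightarrow> 'a) \<Rightarrow> int \<Rightarrow> 'b) \<Rightarrow> bool" where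
  "open_with_uniform_lifting_length X Y \<phi> \<longleftrightarrow>
     open_map (seq_top X) (seq_top Y) \<phi> \<and>
     (\<exists>k. (\<forall>l. lifting_length X Y \<phi> l (k l)) \<and> bdd_above (range (\<lambda>l. \<bar>int (k l) - int l\<bar>)))"

end

theory Submission
  imports Defs
begin

text \<open>
  Let \<open>n\<close> be a bi-retract and let \<open>m\<close> bound the lengths of the words forbidden in \<open>Y\<close>. The claim is
  that \<open>k(l) = l + n + m\<close> is a lifting length for \<open>l\<close>. Let \<open>\<phi> x\<close> and \<open>y\<close> agree on \<open>[- k, k]\<close>, where
  \<open>k = k(l)\<close>. By compactness it suffices to treat \<open>x\<close> and \<open>y\<close> from dense sets
  (\<open>lifting_length_by_density\<close>), so let \<open>x\<close> be left transitive in \<open>X\<close> and \<open>y\<close> right transitive in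
  \<open>Y\<close>. Such points are dense by the Baire category theorem as soon as \<open>X\<close>, and therefore \<open>Y\<close>, is an
  irreducible shift.

  As \<open>Y\<close> is of finite type, the point \<open>z\<close> that follows \<open>\<phi> x\<close> up to \<open>k\<close> and \<open>y\<close> from \<open>- k\<close> on
  lies in \<open>Y\<close>. The right retract gives a lift \<open>x1\<close> of \<open>z\<close> that agrees with \<open>x\<close> up to
  \<open>k - n\<close>. If \<open>x1\<close> is right transitive, then the left retract gives a lift of \<open>y\<close> that agrees with
  \<open>x1\<close> from \<open>- k + n\<close> on, hence with \<open>x\<close> on \<open>[- k + n, k - n]\<close> (\<open>lift_transitive_pair\<close>).

  The point \<open>x1\<close> is right transitive because its image \<open>z\<close> is (\<open>right_transitive_lift\<close>): the
  omega-limit set of \<open>x1\<close> is a subsystem \<open>Z\<close> with \<open>\<phi> ` Z = Y\<close>. If \<open>\<phi>\<close> is irreducible, this forces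
  \<open>Z = X\<close>. If proper subsystems have smaller entropy, it follows from \<open>h(Z) \<ge> h(Y) \<ge> h(X)\<close>, where
  \<open>h\<close> is the entropy. The second inequality is Bowen's inequality for finite-to-one codes
  (\<open>finite_to_one_entropy_le\<close>): the number of lifts of a word of \<open>Y\<close> grows subexponentially with
  its length.

  In the entropy case the irreducibility of \<open>X\<close> must be derived
  (\<open>entropy_minimal_imp_irreducible\<close>). If no word of \<open>X\<close> contains \<open>u\<close> followed by a disjoint
  occurrence of \<open>v\<close>, then each word of \<open>X\<close> is, up to one letter, a word without \<open>u\<close> followed by a
  word without \<open>v\<close>. The growth rates of the two kinds of words are at most the entropies of the
  proper subsystems of points without \<open>u\<close> and without \<open>v\<close> (\<open>count_growth\<close>), so the entropy of \<open>X\<close>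
  would be too small.
\<close>

section \<open>Agreement on windows and the topology of a shift space\<close>

text \<open>Agreement of two sequences on the window \<open>[- k, k]\<close>. Every topological notion used below is
  expressed through it.\<close>

definition agree :: "nat \<Rightarrow> (int \<Rightarrow> 'a) \<Rightarrow> (int \<Rightarrow> 'a) \<Rightarrow> bool" where
  "agree k x y \<longleftrightarrow> (\<forall>i\<in>{- int k..int k}. x i = y i)"

lemma agree_refl [simp]: "agree k x x"
  by (simp add: agree_def)

lemma agree_sym: "agree k x y \<Longrightarrow> agree k y x"
  by (simp add: agree_def)

lemma agree_trans: "agree k x y \<Longrightarrow> agree k y z \<Longrightarrow> agree k x z"
  by (simp add: agree_def)

lemma agree_mono: "agree k x y \<Longrightarrow> l \<le> k \<Longrightarrow> agree l x y"
  by (simp add: agree_def)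

lemma agreeD: "agree k x y \<Longrightarrow> \<bar>i\<bar> \<le> int k \<Longrightarrow> x i = y i"
  unfolding agree_def by (drule bspec[of _ _ i]) auto

lemma agree_all_eq: "(\<And>k. agree k x y) \<Longrightarrow> x = y"
proof
  fix i assume *: "\<And>k. agree k x y"
  show "x i = y i" by (rule agreeD[OF *[of "nat \<bar>i\<bar>"]]) auto
qed

lemma openin_seq_top:
  "openin (seq_top X) U \<longleftrightarrow> U \<subseteq> X \<and> (\<forall>x\<in>U. \<exists>k. \<forall>x'\<in>X. agree k x x' \<longrightarrow> x' \<in> U)"
  (is "?L \<longleftrightarrow> ?R")
proof
  let ?P = "product_topology (\<lambda>_::int. discrete_topology (UNIV::'a set)) UNIV"
  {
    assume ?L
    then obtain T where T: "openin ?P T" "U = T \<inter> X"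
      by (auto simp: seq_top_def openin_subtopology)
    have "\<exists>k. \<forall>x'\<in>X. agree k x x' \<longrightarrow> x' \<in> U" if "x \<in> U" for x
    proof -
      have "x \<in> T" using that T(2) by simp
      from bspec[OF T(1)[unfolded openin_product_topology_alt] this]
      obtain V where V: "finite {i. V i \<noteq> UNIV}" "x \<in> Pi\<^sub>E UNIV V" "Pi\<^sub>E UNIV V \<subseteq> T"
        by auto
      define k where "k = nat (Max (insert 0 (abs ` {i. V i \<noteq> UNIV})))"
      have k: "\<bar>i\<bar> \<le> int k" if "V i \<noteq> UNIV" for i
      proof -
        have "\<bar>i\<bar> \<le> Max (insert 0 (abs ` {i. V i \<noteq> UNIV}))"
          using V(1) that by (intro Max_ge finite.insertI finite_imageI insertI2 imageI CollectI)
        then show ?thesis unfolding k_def by linarith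
      qed
      have "x' \<in> Pi\<^sub>E UNIV V" if "agree k x x'" for x'
      proof (rule PiE_I)
        fix i
        show "x' i \<in> V i"
          using PiE_mem[OF V(2), of i] k[of i] agreeD[OF that, of i] by (cases "V i = UNIV") auto
      qed auto
      then show ?thesis using V(3) T(2) by blast
    qed
    then show ?R using T(2) by blast
  }
  assume R: ?R
  then obtain k where k: "\<And>x x'. x \<in> U \<Longrightarrow> x' \<in> X \<Longrightarrow> agree (k x) x x' \<Longrightarrow> x' \<in> U"
    by metis
  define T where "T = {x'. \<exists>x\<in>U. agree (k x) x x'}"
  have "openin ?P T"
    unfolding openin_product_topology_alt
  proof
    fix x' assume "x' \<in> T"
    then obtain x where x: "x \<in> U" "agree (k x) x x'" by (auto simp: T_def)
    let ?V = "\<lambda>i. if i \<in> {- int (k x)..int (k x)} then {x i} else UNIV"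
    have "finite {i \<in> UNIV. ?V i \<noteq> topspace (discrete_topology UNIV)}"
      by (rule finite_subset[of _ "{- int (k x)..int (k x)}"]) auto
    moreover have "x' \<in> Pi\<^sub>E UNIV ?V" using agreeD[OF x(2)] by auto
    moreover have "Pi\<^sub>E UNIV ?V \<subseteq> T"
    proof
      fix z assume z: "z \<in> Pi\<^sub>E UNIV ?V"
      have "x i = z i" if "i \<in> {- int (k x)..int (k x)}" for i
        using PiE_mem[OF z, of i] that by simp
      then show "z \<in> T" using x(1) unfolding T_def agree_def by blast
    qed
    ultimately show "\<exists>V. finite {i \<in> UNIV. V i \<noteq> topspace (discrete_topology UNIV)} \<and>
      (\<forall>i\<in>UNIV. openin (discrete_topology UNIV) (V i)) \<and> x' \<in> Pi\<^sub>E UNIV V \<and> Pi\<^sub>E UNIV V \<subseteq> T"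
      by (intro exI[of _ ?V] conjI ballI) (assumption | simp)+
  qed
  moreover have "U = T \<inter> X"
  proof
    show "U \<subseteq> T \<inter> X" using R agree_refl unfolding T_def by blast
    show "T \<inter> X \<subseteq> U" using k unfolding T_def by blast
  qed
  ultimately show ?L unfolding seq_top_def openin_subtopology by blast
qed

lemma topspace_seq_top [simp]: "topspace (seq_top X) = X"
  by (auto simp: seq_top_def)

lemma closedin_seq_top:
  "closedin (seq_top X) C \<longleftrightarrow> C \<subseteq> X \<and> (\<forall>x\<in>X. (\<forall>k. \<exists>c\<in>C. agree k x c) \<longrightarrow> x \<in> C)"
  unfolding closedin_def topspace_seq_top openin_seq_top by blast

lemma continuous_map_seq_top:
  assumes "continuous_map (seq_top X) (seq_top Y) f" and "x \<in> X"
  shows "\<exists>l. \<forall>x'\<in>X. agree l x x' \<longrightarrow> agree k (f x) (f x')"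
proof -
  have fY: "f x \<in> Y" if "x \<in> X" for x
    using assms(1) that by (auto simp: continuous_map_def)
  have "openin (seq_top Y) {y\<in>Y. agree k (f x) y}"
    unfolding openin_seq_top by (blast intro: agree_trans)
  then have "openin (seq_top X) {z \<in> topspace (seq_top X). f z \<in> {y\<in>Y. agree k (f x) y}}"
    using assms(1) by (rule openin_continuous_map_preimage[rotated])
  then show ?thesis
    using assms(2) fY unfolding openin_seq_top by force
qed

section \<open>Shift spaces\<close>

text \<open>The \<open>t\<close>-th power of the shift map, for \<open>t\<close> of either sign.\<close>

definition translate :: "int \<Rightarrow> (int \<Rightarrow> 'a) \<Rightarrow> int \<Rightarrow> 'a" where
  "translate t x = (\<lambda>i. x (i + t))"

lemma translate_apply: "translate t x i = x (i + t)"
  by (simp add: translate_def)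

lemma translate_translate [simp]: "translate s (translate t x) = translate (s + t) x"
  by (simp add: translate_def algebra_simps)

lemma translate_0 [simp]: "translate 0 x = x"
  by (simp add: translate_def)

lemma shift_map_eq: "shift_map = translate 1"
  by (simp add: shift_map_def translate_def fun_eq_iff)

lemma shift_invariant_translate:
  assumes "shift_map ` X = X" "x \<in> X"
  shows "translate t x \<in> X"
proof -
  have fw: "translate 1 x \<in> X" if "x \<in> X" for x
    using imageI[OF that, of shift_map] unfolding assms(1) by (simp add: shift_map_eq)
  have bw: "translate (-1) x \<in> X" if "x \<in> X" for x
  proof -
    from that have "x \<in> shift_map ` X" unfolding assms(1) .
    then obtain z where "z \<in> X" "x = translate 1 z" unfolding shift_map_eq by (rule imageE)
    then show ?thesis by simp
  qed
  have "translate (int n) x \<in> X" for n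
  proof (induction n)
    case (Suc n)
    from fw[OF this] show ?case by simp
  qed (use assms in simp)
  moreover have "translate (- int n) x \<in> X" for n
  proof (induction n)
    case (Suc n)
    from bw[OF this] show ?case by simp
  qed (use assms in simp)
  ultimately show ?thesis by (cases t rule: int_cases2) simp_all
qed

lemma shift_space_translate: "shift_space X \<Longrightarrow> x \<in> X \<Longrightarrow> translate t x \<in> X"
  by (auto simp: shift_space_def intro: shift_invariant_translate)

lemma translate_invariant_image:
  assumes "\<And>t x. x \<in> X \<Longrightarrow> translate t x \<in> X"
  shows "shift_map ` X = X"
proof -
  have "x \<in> translate 1 ` X" if "x \<in> X" for x
    using assms[OF that, of "-1"] by (intro image_eqI[of _ _ "translate (-1) x"]) auto
  then show ?thesis using assms unfolding shift_map_eq by blast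
qed

lemma shift_space_alphabet:
  assumes "shift_space X"
  shows "\<exists>A. finite A \<and> (\<forall>x\<in>X. \<forall>i. x i \<in> A) \<and> closedin (seq_top (full_shift A)) X"
proof -
  obtain A where A: "finite A" "closedin (seq_top (full_shift A)) X"
    using assms by (auto simp: shift_space_def)
  moreover have "X \<subseteq> full_shift A" using A(2) by (auto simp: closedin_def)
  ultimately show ?thesis unfolding full_shift_def by blast
qed

lemma shift_space_closed:
  assumes "shift_space X" "\<And>k. \<exists>c\<in>X. agree k x c"
  shows "x \<in> X"
proof -
  obtain A where A: "\<And>x i. x \<in> X \<Longrightarrow> x i \<in> A" "closedin (seq_top (full_shift A)) X"
    using shift_space_alphabet[OF assms(1)] by blast
  have "x i \<in> A" for i
  proof -
    obtain c where "c \<in> X" "agree (nat \<bar>i\<bar>) x c" using assms(2) by blast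
    then show ?thesis using A(1)[of c i] agreeD[of "nat \<bar>i\<bar>" x c i] by simp
  qed
  then have "x \<in> full_shift A" by (auto simp: full_shift_def)
  then show ?thesis using A(2) assms(2) by (auto simp: closedin_seq_top)
qed

lemma subsystem_iff:
  assumes X: "shift_space X"
  shows "subsystem Z X \<longleftrightarrow> closedin (seq_top X) Z \<and> shift_map ` Z = Z"
proof
  assume Z: "subsystem Z X"
  then have "shift_space Z" "Z \<subseteq> X" by (simp_all add: subsystem_def)
  moreover from this have "shift_map ` Z = Z" by (simp add: shift_space_def)
  ultimately show "closedin (seq_top X) Z \<and> shift_map ` Z = Z"
    unfolding closedin_seq_top using shift_space_closed[of Z] by meson
next
  assume Z: "closedin (seq_top X) Z \<and> shift_map ` Z = Z"
  obtain A where A: "finite A" "\<And>x i. x \<in> X \<Longrightarrow> x i \<in> A" "closedin (seq_top (full_shift A)) X"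
    using shift_space_alphabet[OF X] by blast
  have "Z \<subseteq> X" "Z \<subseteq> full_shift A" 
    using Z A(2) by (auto simp: closedin_seq_top full_shift_def)
  moreover have "closedin (seq_top (full_shift A)) Z"
    unfolding closedin_seq_top
  proof (intro conjI ballI impI)
    fix x assume "\<forall>k. \<exists>c\<in>Z. agree k x c"
    moreover from this have "x \<in> X"
      using \<open>Z \<subseteq> X\<close> by (intro shift_space_closed[OF X]) blast
    ultimately show "x \<in> Z" using Z by (auto simp: closedin_seq_top)
  qed fact
  ultimately show "subsystem Z X" using Z A(1) unfolding subsystem_def shift_space_def by blast
qed

lemma subsystemI:
  assumes X: "shift_space X" and "Z \<subseteq> X"
    and "\<And>t x. x \<in> Z \<Longrightarrow> translate t x \<in> Z"
    and "\<And>x. x \<in> X \<Longrightarrow> (\<And>k. \<exists>c\<in>Z. agree k x c) \<Longrightarrow> x \<in> Z"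
  shows "subsystem Z X"
  unfolding subsystem_iff[OF X] closedin_seq_top
  using assms(2,4) translate_invariant_image[of Z] assms(3) by blast

lemma compact_shift_space:
  assumes "shift_space X"
  shows "compact_space (seq_top X)"
proof -
  obtain A where A: "finite A" "\<And>x i. x \<in> X \<Longrightarrow> x i \<in> A" "closedin (seq_top (full_shift A)) X"
    using shift_space_alphabet[OF assms] by blast
  have "full_shift A = (\<Pi>\<^sub>E i\<in>UNIV. A)" by (auto simp: full_shift_def)
  then have "seq_top (full_shift A) = product_topology (\<lambda>_. discrete_topology A) UNIV"
    unfolding seq_top_def using subtopology_product_topology[of "\<lambda>_. discrete_topology UNIV" UNIV "\<lambda>_. A"]
    by (simp add: subtopology_discrete_topology)
  then have "compact_space (seq_top (full_shift A))"
    using A(1) by (simp add: compact_space_product_topology compact_space_discrete_topology)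
  then have "compact_space (subtopology (seq_top (full_shift A)) X)"
    using A(3) by (intro compact_space_subtopology closedin_compact_space)
  moreover have "subtopology (seq_top (full_shift A)) X = seq_top X"
    using A(2) by (auto simp: seq_top_def subtopology_subtopology full_shift_def
        intro!: arg_cong[of _ _ "subtopology _"])
  ultimately show ?thesis by simp
qed

text \<open>Compactness in the form of cluster points of sequences.\<close>

lemma cluster_point:
  fixes s :: "nat \<Rightarrow> int \<Rightarrow> 'a"
  assumes X: "shift_space X" and s: "\<And>n. s n \<in> X"
  obtains x where "x \<in> X" "\<And>k N. \<exists>n\<ge>N. agree k x (s n)"
proof -
  define C where "C N = {x\<in>X. \<forall>k. \<exists>n\<ge>N. agree k x (s n)}" for N :: nat
  have "closedin (seq_top X) (C N)" for N
    unfolding closedin_seq_top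
  proof (intro conjI ballI impI)
    fix x assume x: "x \<in> X" "\<forall>k. \<exists>c\<in>C N. agree k x c"
    have "\<exists>n\<ge>N. agree k x (s n)" for k
    proof -
      obtain c where "c \<in> C N" "agree k x c" using x by blast
      then show ?thesis unfolding C_def by (blast intro: agree_trans)
    qed
    with x show "x \<in> C N" by (simp add: C_def)
  qed (auto simp: C_def)
  moreover have "s N \<in> C N" for N
    using s by (auto simp: C_def intro: agree_refl)
  then have "C N \<noteq> {}" for N by blast
  moreover have "decseq C"
    unfolding decseq_def C_def by (blast intro: order_trans)
  ultimately have "\<Inter>(range C) \<noteq> {}"
    by (rule compact_space_imp_nest[OF compact_shift_space[OF X]])
  then obtain x where "\<And>N. x \<in> C N" by blast
  then show ?thesis by (intro that[of x]) (auto simp: C_def)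
qed

lemma Hausdorff_seq_top: "Hausdorff_space (seq_top X)"
  unfolding seq_top_def
  by (intro Hausdorff_space_subtopology) (simp add: Hausdorff_space_product_topology)

text \<open>A countable intersection of open dense sets is dense.\<close>

lemma Baire_shift_space:
  assumes X: "shift_space X" and "countable I"
    and op: "\<And>i. i \<in> I \<Longrightarrow> openin (seq_top X) (U i)"
    and dense: "\<And>i x k. i \<in> I \<Longrightarrow> x \<in> X \<Longrightarrow> \<exists>x'\<in>U i. agree k x x'"
    and x: "x \<in> X"
  shows "\<exists>x'\<in>X. agree k x x' \<and> (\<forall>i\<in>I. x' \<in> U i)"
proof -
  have cl: "x \<in> seq_top X closure_of S" 
    if "S \<subseteq> X" "\<And>k. \<exists>x'\<in>S. agree k x x'" "x \<in> X" for S x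
    unfolding closure_of_def topspace_seq_top openin_seq_top
  proof (intro CollectI conjI allI impI)
    fix T assume T: "x \<in> T \<and> T \<subseteq> X \<and> (\<forall>x\<in>T. \<exists>k. \<forall>x'\<in>X. agree k x x' \<longrightarrow> x' \<in> T)"
    then obtain k where k: "\<forall>x'\<in>X. agree k x x' \<longrightarrow> x' \<in> T" by blast
    obtain x' where "x' \<in> S" "agree k x x'" using \<open>\<And>k. \<exists>x'\<in>S. agree k x x'\<close> by blast
    with k \<open>S \<subseteq> X\<close> show "\<exists>y\<in>S. y \<in> T" by blast
  qed fact
  have "seq_top X closure_of \<Inter>(insert X (U ` I)) = topspace (seq_top X)"
  proof (rule Baire_category)
    show "completely_metrizable_space (seq_top X) \<or>
        locally_compact_space (seq_top X) \<and> regular_space (seq_top X)"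
      using compact_shift_space[OF X] Hausdorff_seq_top
      by (auto intro: compact_imp_locally_compact_space compact_Hausdorff_imp_regular_space)
    fix T assume T: "T \<in> insert X (U ` I)"
    have o: "openin (seq_top X) T" using T op openin_topspace[of "seq_top X"] by auto
    moreover have "X \<subseteq> seq_top X closure_of T"
    proof
      fix x assume "x \<in> X"
      show "x \<in> seq_top X closure_of T"
      proof (rule cl)
        show "T \<subseteq> X" using o by (simp add: openin_seq_top)
        show "\<exists>x'\<in>T. agree k x x'" for k
          using T dense[OF _ \<open>x \<in> X\<close>] agree_refl \<open>x \<in> X\<close> by blast
      qed fact
    qed
    ultimately show "openin (seq_top X) T \<and> seq_top X closure_of T = topspace (seq_top X)"
      using closure_of_subset_topspace[of "seq_top X" T] by auto
  qed (use assms in auto)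
  then have "x \<in> seq_top X closure_of \<Inter>(insert X (U ` I))" using x by simp
  moreover have "openin (seq_top X) {x'\<in>X. agree k x x'}"
    unfolding openin_seq_top by (blast intro: agree_trans)
  moreover have "x \<in> {x'\<in>X. agree k x x'}" using x by simp
  ultimately obtain y where "y \<in> \<Inter>(insert X (U ` I))" "y \<in> {x'\<in>X. agree k x x'}"
    unfolding in_closure_of by meson
  then show ?thesis by blast
qed

section \<open>Blocks\<close>

text \<open>The word read off in the coordinates \<open>[i, i + n)\<close>.\<close>

definition block :: "(int \<Rightarrow> 'a) \<Rightarrow> int \<Rightarrow> nat \<Rightarrow> 'a list" where
  "block x i n = map (\<lambda>j. x (i + int j)) [0..<n]"

lemma length_block [simp]: "length (block x i n) = n"
  by (simp add: block_def)

lemma nth_block [simp]: "j < n \<Longrightarrow> block x i n ! j = x (i + int j)"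
  by (simp add: block_def)

lemma occurs_at_iff_block: "occurs_at w x i \<longleftrightarrow> w = block x i (length w)"
  by (auto simp: occurs_at_def list_eq_iff_nth_eq)

lemma block_append: "block x i (m + n) = block x i m @ block x (i + int m) n"
  by (rule nth_equalityI) (auto simp: nth_append algebra_simps of_nat_diff)

lemma take_block: "take m (block x i n) = block x i (min m n)"
  by (rule nth_equalityI) auto

lemma drop_block: "drop m (block x i n) = block x (i + int m) (n - m)"
  by (rule nth_equalityI) (auto simp: algebra_simps)

lemma append_eq_block:
  assumes "us @ vs = block x i n"
  shows "us = block x i (length us)" "vs = block x (i + int (length us)) (length vs)"
proof -
  have n: "n = length us + length vs" using arg_cong[OF assms, of length] by simp
  have "us = take (length us) (us @ vs)" "vs = drop (length us) (us @ vs)" by simp_all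
  then show "us = block x i (length us)" "vs = block x (i + int (length us)) (length vs)"
    unfolding assms take_block drop_block n by simp_all
qed

lemma block_translate: "block (translate t x) i n = block x (i + t) n"
  by (simp add: block_def translate_def algebra_simps)

lemma block_cong: "(\<And>j. i \<le> j \<Longrightarrow> j < i + int n \<Longrightarrow> x j = y j) \<Longrightarrow> block x i n = block y i n"
  by (rule nth_equalityI) auto

lemma block_eqD: "block x i n = block y i n \<Longrightarrow> i \<le> j \<Longrightarrow> j < i + int n \<Longrightarrow> x j = y j"
proof -
  assume *: "block x i n = block y i n" "i \<le> j" "j < i + int n"
  then have "x (i + int (nat (j - i))) = y (i + int (nat (j - i)))"
    using nth_block[of "nat (j - i)" n x i] nth_block[of "nat (j - i)" n y i] by simp
  then show "x j = y j" using * by simp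
qed

lemma agree_block: "agree k x y \<Longrightarrow> - int k \<le> i \<Longrightarrow> i + int n \<le> int k + 1 \<Longrightarrow> block x i n = block y i n"
  by (rule block_cong) (auto intro: agreeD)

lemma language_eq: "language X = {w. \<exists>x\<in>X. \<exists>i n. w = block x i n}"
  unfolding language_def occurs_at_iff_block using length_block by metis

lemma block_in_language: "x \<in> X \<Longrightarrow> block x i n \<in> language X"
  by (auto simp: language_eq)

text \<open>By shift invariance a word of the language can be found at any prescribed coordinate.\<close>

lemma languageE:
  assumes "shift_space X" "w \<in> language X"
  obtains x where "x \<in> X" "w = block x i (length w)"
proof -
  obtain x j where x: "x \<in> X" "w = block x j (length w)"
    using assms(2) by (auto simp: language_def occurs_at_iff_block)
  then have "w = block (translate (j - i) x) i (length w)" by (simp add: block_translate)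
  then show ?thesis using that shift_space_translate[OF assms(1) x(1)] by blast
qed

lemma words_eq: "shift_space X \<Longrightarrow> words X n = {block x i n | x. x \<in> X}"
  unfolding words_def by (auto simp: block_in_language elim: languageE[where i = i])

lemma language_subword: "u @ w @ v \<in> language X \<Longrightarrow> w \<in> language X"
proof -
  assume "u @ w @ v \<in> language X"
  then obtain x i n where x: "x \<in> X" "u @ w @ v = block x i n" by (auto simp: language_eq)
  have "w = take (length w) (drop (length u) (u @ w @ v))" by simp
  then show ?thesis unfolding x(2) using x(1) by (metis block_in_language drop_block take_block)
qed

lemma language_appendD:
  "u @ v \<in> language X \<Longrightarrow> u \<in> language X" "u @ v \<in> language X \<Longrightarrow> v \<in> language X"
  using language_subword[of "[]" u v X] language_subword[of u v "[]" X] by auto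

lemma language_subset_lists:
  assumes "shift_space X"
  shows "\<exists>A. finite A \<and> language X \<subseteq> lists A"
proof -
  obtain A where "finite A" "\<And>x i. x \<in> X \<Longrightarrow> x i \<in> A"
    using shift_space_alphabet[OF assms] by blast
  then show ?thesis by (intro exI[of _ A]) (auto simp: language_eq block_def)
qed

lemma finite_language_length:
  assumes "shift_space X" "L \<subseteq> language X"
  shows "finite {w\<in>L. length w = n}"
proof -
  obtain A where "finite A" "language X \<subseteq> lists A" using language_subset_lists[OF assms(1)] by blast
  then show ?thesis
    using assms(2) by (intro finite_subset[OF _ finite_lists_length_eq[of A n]]) auto
qed

lemma finite_words: "shift_space X \<Longrightarrow> finite (words X n)"
  unfolding words_def by (rule finite_language_length) auto

lemma countable_language:
  assumes "shift_space X"
  shows "countable (language X)"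
proof -
  obtain A where "finite A" "language X \<subseteq> lists A"
    using language_subset_lists[OF assms] by blast
  then show ?thesis by (meson countable_finite countable_lists countable_subset)
qed

section \<open>Transitive points\<close>

lemma infinite_below_iff: "infinite {i::int. i \<le> 0 \<and> P i} \<longleftrightarrow> (\<forall>N::nat. \<exists>i\<le>- int N. P i)"
proof
  assume inf: "infinite {i. i \<le> 0 \<and> P i}"
  show "\<forall>N::nat. \<exists>i\<le>- int N. P i"
  proof (rule ccontr)
    assume "\<not> ?thesis"
    then obtain N :: nat where "\<And>i. i \<le> - int N \<Longrightarrow> \<not> P i" by blast
    then have "{i. i \<le> 0 \<and> P i} \<subseteq> {- int N..0}"
      by (auto simp: not_le) (meson linear)
    with inf show False using finite_subset by blast
  qed
next
  assume R: "\<forall>N::nat. \<exists>i\<le>- int N. P i"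
  show "infinite {i. i \<le> 0 \<and> P i}"
  proof
    assume fin: "finite {i. i \<le> 0 \<and> P i}"
    obtain j where j: "\<And>i. i \<le> 0 \<Longrightarrow> P i \<Longrightarrow> j \<le> i"
      using bdd_below_finite[OF fin] by (auto simp: bdd_below_def)
    obtain i where "i \<le> - int (nat (\<bar>j\<bar> + 1))" "P i" using R by blast
    with j[of i] show False by auto
  qed
qed

lemma infinite_above_iff: "infinite {i::int. 0 \<le> i \<and> P i} \<longleftrightarrow> (\<forall>N::nat. \<exists>i\<ge>int N. P i)"
proof -
  have "{i. 0 \<le> i \<and> P i} = uminus ` {i. i \<le> 0 \<and> P (- i)}"
    by (auto simp: image_iff intro!: exI[of _ "- _"])
  then have "infinite {i. 0 \<le> i \<and> P i} \<longleftrightarrow> infinite {i. i \<le> 0 \<and> P (- i)}"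
    by (simp add: finite_image_iff inj_on_def)
  also have "\<dots> \<longleftrightarrow> (\<forall>N::nat. \<exists>i\<ge>int N. P i)"
    unfolding infinite_below_iff by (metis minus_le_iff neg_le_iff_le minus_minus)
  finally show ?thesis .
qed

lemma left_transitive_iff:
  "left_transitive X x \<longleftrightarrow> x \<in> X \<and> (\<forall>w\<in>language X. \<forall>N::nat. \<exists>i\<le>- int N. occurs_at w x i)"
  unfolding left_transitive_def infinite_below_iff ..

lemma right_transitive_iff:
  "right_transitive X x \<longleftrightarrow> x \<in> X \<and> (\<forall>w\<in>language X. \<forall>N::nat. \<exists>i\<ge>int N. occurs_at w x i)"
  unfolding right_transitive_def infinite_above_iff ..

lemma openin_occurs: "openin (seq_top X) {x\<in>X. \<exists>i\<in>I. occurs_at w x i}"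
  unfolding openin_seq_top
proof (intro conjI ballI)
  fix x assume "x \<in> {x\<in>X. \<exists>i\<in>I. occurs_at w x i}"
  then obtain i where i: "i \<in> I" "w = block x i (length w)" by (auto simp: occurs_at_iff_block)
  have "w = block x' i (length w)" if "agree (nat \<bar>i\<bar> + length w) x x'" for x'
    using agree_block[OF that, of i "length w"] i(2) by simp
  then show "\<exists>k. \<forall>x'\<in>X. agree k x x' \<longrightarrow> x' \<in> {x \<in> X. \<exists>i\<in>I. occurs_at w x i}"
    using i(1) by (auto simp: occurs_at_iff_block)
qed auto

lemma dense_left_transitive:
  assumes X: "shift_space X" and irr: "irreducible_shift X" and "x \<in> X"
  shows "\<exists>x'. left_transitive X x' \<and> agree k x x'"
proof -
  define U where "U = (\<lambda>(w, N::nat). {x\<in>X. \<exists>i\<in>{..- int N}. occurs_at w x i})"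
  have "countable (language X \<times> (UNIV :: nat set))"
    using countable_language[OF X] by auto
  then have "\<exists>x'\<in>X. agree k x x' \<and> (\<forall>p\<in>language X \<times> UNIV. x' \<in> U p)"
  proof (rule Baire_shift_space[OF X _ _ _ \<open>x \<in> X\<close>])
    fix p assume "p \<in> language X \<times> (UNIV :: nat set)"
    then obtain w N where p: "p = (w, N)" "w \<in> language X" by auto
    show "openin (seq_top X) (U p)"
      unfolding p U_def using openin_occurs by simp
    fix x k assume x: "x \<in> X"
    define M where "M = max k N"
    \<comment> \<open>The block is extended to the left to \<open>- N\<close> or further, which pushes \<open>w\<close> beyond that coordinate.\<close>
    obtain u where "w @ u @ block x (- int M) (M + k + 1) \<in> language X"
      using irr p(2) block_in_language[OF x] unfolding irreducible_shift_def by blast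
    then obtain x' n where x': "x' \<in> X"
        "w @ u @ block x (- int M) (M + k + 1) = block x' (- int M - int (length (w @ u))) n"
      using languageE[OF X] by metis
    from append_eq_block[OF x'(2)] append_eq_block(2)[of "w @ u" "block x (- int M) (M + k + 1)" x'] x'(2)
    have "w = block x' (- int M - int (length (w @ u))) (length w)"
      and "block x (- int M) (M + k + 1) = block x' (- int M) (M + k + 1)"
      by auto
    then have "x' \<in> U p" "agree k x x'"
      using x'(1) block_eqD[of x "- int M" "M + k + 1" x']
      by (auto simp: U_def p occurs_at_iff_block M_def agree_def
          intro!: bexI[of _ "- int M - int (length (w @ u))"])
    then show "\<exists>x'\<in>U p. agree k x x'" by blast
  qed
  then show ?thesis unfolding left_transitive_iff U_def by fastforce
qed

lemma dense_right_transitive: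
  assumes X: "shift_space X" and irr: "irreducible_shift X" and "x \<in> X"
  shows "\<exists>x'. right_transitive X x' \<and> agree k x x'"
proof -
  define U where "U = (\<lambda>(w, N::nat). {x\<in>X. \<exists>i\<in>{int N..}. occurs_at w x i})"
  have "countable (language X \<times> (UNIV :: nat set))"
    using countable_language[OF X] by auto
  then have "\<exists>x'\<in>X. agree k x x' \<and> (\<forall>p\<in>language X \<times> UNIV. x' \<in> U p)"
  proof (rule Baire_shift_space[OF X _ _ _ \<open>x \<in> X\<close>])
    fix p assume "p \<in> language X \<times> (UNIV :: nat set)"
    then obtain w N where p: "p = (w, N)" "w \<in> language X" by auto
    show "openin (seq_top X) (U p)"
      unfolding p U_def using openin_occurs by simp
    fix x k assume x: "x \<in> X"
    define M where "M = max k N"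
    obtain u where "block x (- int k) (k + M + 1) @ u @ w \<in> language X"
      using irr p(2) block_in_language[OF x] unfolding irreducible_shift_def by blast
    then obtain x' n where x': "x' \<in> X"
        "block x (- int k) (k + M + 1) @ u @ w = block x' (- int k) n"
      using languageE[OF X] by metis
    from append_eq_block[OF x'(2)] append_eq_block(2)[OF append_eq_block(2)[OF x'(2)]]
    have "w = block x' (int M + 1 + int (length u)) (length w)"
      and "block x (- int k) (k + M + 1) = block x' (- int k) (k + M + 1)"
      by (auto simp: algebra_simps)
    then have "x' \<in> U p" "agree k x x'"
      using x'(1) block_eqD[of x "- int k" "k + M + 1" x']
      by (auto simp: U_def p occurs_at_iff_block M_def agree_def
          intro!: bexI[of _ "int M + 1 + int (length u)"])
    then show "\<exists>x'\<in>U p. agree k x x'" by blast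
  qed
  then show ?thesis unfolding right_transitive_iff U_def by fastforce
qed

section \<open>Growth rates and entropy\<close>

text \<open>Fekete's lemma for nonnegative sequences, including that the limit is a lower bound.\<close>

lemma subadditive_limit:
  fixes a :: "nat \<Rightarrow> real"
  assumes sub: "\<And>m n. a (m + n) \<le> a m + a n" and nonneg: "\<And>n. 0 \<le> a n"
  shows "\<exists>L. (\<lambda>n. a n / real n) \<longlonglongrightarrow> L \<and> (\<forall>n. L * real n \<le> a n)"
proof -
  define L where "L = (INF n\<in>{1..}. a n / real n)"
  have bdd: "bdd_below ((\<lambda>n. a n / real n) ` {1..})"
    using nonneg by (intro bdd_belowI2[of _ 0]) simp
  have low: "L \<le> a n / real n" if "1 \<le> n" for n
    unfolding L_def using that bdd by (intro cINF_lower) auto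
  have mult: "a (q * m + r) \<le> real q * a m + a r" for q m r
  proof (induction q)
    case (Suc q)
    have "a (Suc q * m + r) \<le> a m + a (q * m + r)"
      using sub[of m "q * m + r"] by (simp add: add.assoc)
    with Suc show ?case by (simp add: algebra_simps)
  qed simp
  have "(\<lambda>n. a n / real n) \<longlonglongrightarrow> L"
  proof (rule LIMSEQ_I)
    fix e :: real assume e: "0 < e"
    have "\<exists>m\<in>{1..}. a m / real m < L + e / 2"
      using cINF_less_iff[of "{1..}" "\<lambda>n. a n / real n" "L + e / 2"] bdd e by (auto simp: L_def)
    then obtain m where m: "1 \<le> m" "a m / real m < L + e / 2" by auto
    define B where "B = (\<Sum>r<m. a r)"
    have B: "a r \<le> B" if "r < m" for r
      unfolding B_def using that nonneg by (intro member_le_sum) auto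
    have up: "a n \<le> real n * (a m / real m) + B" for n
    proof -
      have "a n \<le> real (n div m) * a m + a (n mod m)"
        using mult[of "n div m" m "n mod m"] by simp
      also have "\<dots> \<le> real n / real m * a m + B"
        using m(1) nonneg[of m] B[of "n mod m"]
        by (intro add_mono mult_right_mono of_nat_div_le_of_nat) auto
      finally show ?thesis by simp
    qed
    obtain N :: nat where N: "2 * B / e < real N" using reals_Archimedean2 by blast
    have "norm (a n / real n - L) < e" if n: "n \<ge> max 1 N" for n
    proof -
      have "2 * B / e < real n" using N n by simp
      then have "B / real n < e / 2" using e n by (simp add: field_simps)
      moreover have "a n / real n \<le> a m / real m + B / real n"
        using up[of n] n by (simp add: field_simps)
      ultimately have "a n / real n < L + e" using m(2) by linarith
      moreover have "L \<le> a n / real n" using low[of n] n by simp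
      ultimately show ?thesis by (simp add: abs_less_iff)
    qed
    then show "\<exists>N. \<forall>n\<ge>N. norm (a n / real n - L) < e" by blast
  qed
  moreover have "L * real n \<le> a n" for n
    using low[of n] nonneg[of 0] by (cases "n = 0") (auto simp: field_simps)
  ultimately show ?thesis by blast
qed

lemma card_le_take_drop:
  assumes "finite A" "finite B" "\<And>w. w \<in> S \<Longrightarrow> take m w \<in> A \<and> drop m w \<in> B"
  shows "card S \<le> card A * card B"
proof -
  have "card S \<le> card (A \<times> B)"
  proof (rule card_inj_on_le)
    show "inj_on (\<lambda>w. (take m w, drop m w)) S"
      by (rule inj_onI) (metis append_take_drop_id prod.inject)
  qed (use assms in auto)
  then show ?thesis by (simp add: card_cartesian_product)
qed

lemma words_append:
  assumes "w \<in> words X (m + n)"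
  shows "take m w \<in> words X m \<and> drop m w \<in> words X n"
  using assms language_appendD[of "take m w" "drop m w" X] by (auto simp: words_def)

lemma words_nonempty: "x \<in> X \<Longrightarrow> words X n \<noteq> {}"
  using block_in_language[of x X 0 n] by (auto simp: words_def)

text \<open>The limit in the definition of entropy exists, and no term of the sequence lies below it.\<close>

lemma entropy_eq:
  assumes X: "shift_space X" and ne: "X \<noteq> {}"
  obtains h where "entropy X = ereal h"
    "(\<lambda>n. ln (real (card (words X n))) / real n) \<longlonglongrightarrow> h"
    "\<And>n. exp (h * real n) \<le> real (card (words X n))"
proof -
  have pos: "0 < card (words X n)" for n
    using ne words_nonempty finite_words[OF X] by (metis card_gt_0_iff ex_in_conv)
  define a where "a n = ln (real (card (words X n)))" for n
  have "a (m + n) \<le> a m + a n" for m n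
  proof -
    have "card (words X (m + n)) \<le> card (words X m) * card (words X n)"
      using words_append finite_words[OF X] by (intro card_le_take_drop) blast+
    then have "real (card (words X (m + n))) \<le> real (card (words X m)) * real (card (words X n))"
      by (simp flip: of_nat_mult)
    then show ?thesis
      unfolding a_def using pos by (subst ln_mult_pos[symmetric]) auto
  qed
  moreover have "0 \<le> a n" for n
    unfolding a_def using pos[of n] by (intro ln_ge_zero) linarith
  ultimately obtain h where h: "(\<lambda>n. a n / real n) \<longlonglongrightarrow> h" "\<And>n. h * real n \<le> a n"
    using subadditive_limit[of a] by blast
  have "entropy X = ereal h"
    using h(1) ne unfolding a_def by (simp add: entropy_def limI)
  moreover have "exp (h * real n) \<le> real (card (words X n))" for n
    using h(2)[of n] pos[of n] unfolding a_def by (subst (asm) ln_ge_iff) auto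
  ultimately show ?thesis using that h(1) unfolding a_def by blast
qed

text \<open>For \<open>Z = {}\<close> there are no words at all, so \<open>c\<close> may be negative here.\<close>

lemma entropy_less_words:
  assumes Z: "shift_space Z" and c: "entropy Z < ereal c"
  shows "\<exists>m\<ge>1. real (card (words Z m)) \<le> exp (c * real m)"
proof (cases "Z = {}")
  case True
  then show ?thesis by (intro exI[of _ 1]) (simp add: words_def language_def)
next
  case False
  then obtain h where h: "entropy Z = ereal h"
    "(\<lambda>n. ln (real (card (words Z n))) / real n) \<longlonglongrightarrow> h"
    using entropy_eq[OF Z] by metis
  have "\<forall>\<^sub>F n in sequentially. ln (real (card (words Z n))) / real n < c"
    using h c by (intro order_tendstoD) auto
  then obtain N where N: "\<And>n. n \<ge> N \<Longrightarrow> ln (real (card (words Z n))) / real n < c"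
    by (auto simp: eventually_sequentially)
  define m where "m = max 1 N"
  have "ln (real (card (words Z m))) / real m < c" using N[of m] by (simp add: m_def)
  then have "ln (real (card (words Z m))) < c * real m"
    by (simp add: m_def field_simps)
  moreover have "0 < card (words Z m)"
    using False words_nonempty finite_words[OF Z] by (metis card_gt_0_iff ex_in_conv)
  ultimately have "real (card (words Z m)) \<le> exp (c * real m)"
    by (metis exp_le_cancel_iff exp_ln less_imp_le of_nat_0_less_iff)
  then show ?thesis by (intro exI[of _ m]) (simp add: m_def)
qed

lemma exp_growth_step:
  fixes f :: "nat \<Rightarrow> real"
  assumes m: "1 \<le> m" and f: "\<And>j. 0 \<le> f j" "\<And>j. f (j + m) \<le> f j * exp (c * real m)"
  shows "\<exists>C\<ge>0. \<forall>j. f j \<le> C * exp (c * real j)"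
proof -
  define C where "C = (\<Sum>j<m. f j / exp (c * real j))"
  have "f j \<le> C * exp (c * real j)" for j
  proof (induction j rule: less_induct)
    case (less j)
    show ?case
    proof (cases "j < m")
      case True
      then have "f j / exp (c * real j) \<le> C"
        unfolding C_def using f(1) by (intro member_le_sum) auto
      then show ?thesis by (simp add: field_simps)
    next
      case False
      then have "f j \<le> f (j - m) * exp (c * real m)" using f(2)[of "j - m"] by simp
      also have "\<dots> \<le> C * exp (c * real (j - m)) * exp (c * real m)"
        using less[of "j - m"] False m by (intro mult_right_mono) auto
      also have "\<dots> = C * exp (c * real j)"
        using False by (simp add: mult.assoc of_nat_diff algebra_simps flip: exp_add)
      finally show ?thesis .
    qed
  qed
  moreover have "0 \<le> C" unfolding C_def using f(1) by (intro sum_nonneg) auto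
  ultimately show ?thesis by blast
qed

lemma exp_growth_tail:
  fixes f :: "nat \<Rightarrow> real"
  assumes f: "\<And>j. 0 \<le> f j" "\<And>j. f (d + j) \<le> C * exp (c * real j)"
  shows "\<exists>C\<ge>0. \<forall>j. f j \<le> C * exp (c * real j)"
proof -
  define D where "D = (\<Sum>j<d. f j / exp (c * real j))"
  have D: "0 \<le> D" unfolding D_def using f(1) by (intro sum_nonneg) auto
  have C: "0 \<le> C" using f(1)[of d] f(2)[of 0] by simp
  have "f j \<le> (D + C * exp (- c * real d)) * exp (c * real j)" for j
  proof (cases "j < d")
    case True
    then have "f j / exp (c * real j) \<le> D"
      unfolding D_def using f(1) by (intro member_le_sum) auto
    then have "f j \<le> D * exp (c * real j)" by (simp add: field_simps)
    also have "\<dots> \<le> (D + C * exp (- c * real d)) * exp (c * real j)"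
      using C by (intro mult_right_mono) auto
    finally show ?thesis .
  next
    case False
    then have "f j \<le> C * exp (c * real (j - d))" using f(2)[of "j - d"] by simp
    also have "\<dots> = C * exp (- c * real d) * exp (c * real j)"
      using False by (simp add: mult.assoc of_nat_diff algebra_simps flip: exp_add)
    also have "\<dots> \<le> (D + C * exp (- c * real d)) * exp (c * real j)"
      using D by (intro mult_right_mono) auto
    finally show ?thesis .
  qed
  then show ?thesis using C D by (intro exI[of _ "D + C * exp (- c * real d)"]) auto
qed

lemma exp_growth_compare:
  fixes a b K :: real
  assumes "\<And>n. exp (a * real n) \<le> K * real (n + 1) * exp (b * real n)"
  shows "a \<le> b"
proof (rule ccontr)
  assume "\<not> a \<le> b"
  define d where "d = a - b"
  have d: "0 < d" using \<open>\<not> a \<le> b\<close> by (simp add: d_def)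
  have *: "exp (d * real n) \<le> K * real (n + 1)" for n
    using assms[of n] by (simp add: d_def left_diff_distrib exp_diff field_simps)
  have K: "0 < K" using *[of 0] by simp
  obtain n :: nat where n: "8 * K / d\<^sup>2 < real n" using reals_Archimedean2 by blast
  have "0 \<le> 8 * K / d\<^sup>2" using K by simp
  then have n1: "1 \<le> real n" using n by (cases n) auto
  have "(d * real n / 2)\<^sup>2 \<le> (exp (d * real n / 2))\<^sup>2"
  proof (rule power_mono)
    show "d * real n / 2 \<le> exp (d * real n / 2)"
      using exp_ge_add_one_self[of "d * real n / 2"] by linarith
  qed (use d in simp)
  also have "\<dots> = exp (d * real n)"
    by (simp add: power2_eq_square flip: exp_add)
  also have "\<dots> \<le> K * real (n + 1)" by (rule *)
  also have "\<dots> \<le> K * (2 * real n)" using K n1 by (intro mult_left_mono) auto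
  finally have "d\<^sup>2 * real n * real n \<le> 8 * K * real n"
    by (simp add: power2_eq_square field_simps)
  then have "d\<^sup>2 * real n \<le> 8 * K" using n1 by simp
  moreover have "8 * K < d\<^sup>2 * real n" using n d by (simp add: field_simps)
  ultimately show False by simp
qed

text \<open>The number of words of length \<open>n\<close> in \<open>L\<close>, for \<open>L\<close> over a finite alphabet.\<close>

definition count :: "'a list set \<Rightarrow> nat \<Rightarrow> real" where
  "count L n = real (card {w\<in>L. length w = n})"

lemma count_language: "count (language X) n = real (card (words X n))"
  by (simp add: count_def words_def)

lemma count_nonneg [simp]: "0 \<le> count L n"
  by (simp add: count_def)

text \<open>The points all of whose blocks lie in a given set of words.\<close>

lemma subsystem_of_language:
  assumes X: "shift_space X"
  shows "subsystem {x\<in>X. \<forall>i n. block x i n \<in> L} X"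
proof (rule subsystemI[OF X])
  fix t x assume "x \<in> {x\<in>X. \<forall>i n. block x i n \<in> L}"
  then show "translate t x \<in> {x\<in>X. \<forall>i n. block x i n \<in> L}"
    using X by (auto simp: shift_space_translate block_translate)
next
  fix x assume x: "x \<in> X" "\<And>k. \<exists>c\<in>{x\<in>X. \<forall>i n. block x i n \<in> L}. agree k x c"
  have "block x i n \<in> L" for i n
  proof -
    obtain c where c: "block c i n \<in> L" "agree (nat \<bar>i\<bar> + n) x c"
      using x(2)[of "nat \<bar>i\<bar> + n"] by blast
    then have "block x i n = block c i n" by (intro agree_block[OF c(2)]) auto
    with c show ?thesis by simp
  qed
  with x show "x \<in> {x\<in>X. \<forall>i n. block x i n \<in> L}" by blast
qed auto

text \<open>A word of \<open>L\<close> need not occur in any point all of whose blocks lie in \<open>L\<close>. By compactness it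
  does once a sufficiently long margin is removed at both ends.\<close>

lemma central_subword_of_language:
  assumes X: "shift_space X" and L: "L \<subseteq> language X"
    and fac: "\<And>u w v. u @ w @ v \<in> L \<Longrightarrow> w \<in> L"
  shows "\<exists>K. \<forall>w\<in>L. length w = K + m + K \<longrightarrow>
    take m (drop K w) \<in> words {x\<in>X. \<forall>i n. block x i n \<in> L} m"
proof (rule ccontr)
  let ?Z = "{x\<in>X. \<forall>i n. block x i n \<in> L}"
  assume "\<not> ?thesis"
  then have "\<forall>K. \<exists>w. w \<in> L \<and> length w = K + m + K \<and> take m (drop K w) \<notin> words ?Z m"
    by blast
  from choice[OF this] obtain w where w: "\<And>K. w K \<in> L" "\<And>K. length (w K) = K + m + K"
    "\<And>K. take m (drop K (w K)) \<notin> words ?Z m" by blast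
  have "\<exists>x\<in>X. w K = block x (- int K) (K + m + K)" for K
  proof -
    have "w K \<in> language X" using w(1) L by blast
    then obtain x where "x \<in> X" "w K = block x (- int K) (length (w K))"
      by (rule languageE[OF X])
    then show ?thesis unfolding w(2) by blast
  qed
  then obtain s where s: "\<And>K. s K \<in> X" "\<And>K. w K = block (s K) (- int K) (K + m + K)" by metis
  obtain x where x: "x \<in> X" "\<And>k N. \<exists>n\<ge>N. agree k x (s n)"
    using cluster_point[of X s, OF X s(1)] by blast
  have "block x i n \<in> L" for i n
  proof -
    define k where "k = nat \<bar>i\<bar> + n"
    obtain K where K: "K \<ge> k" "agree k x (s K)" using x(2) by blast
    have "block x i n = block (s K) i n"
      by (rule agree_block[OF K(2)]) (auto simp: k_def)
    also have "\<dots> = take n (drop (nat (i + int K)) (w K))"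
      unfolding s(2) drop_block take_block using K(1) by (auto simp: k_def nat_add_distrib min_def)
    also have "\<dots> \<in> L"
      using w(1)[of K] append_take_drop_id fac by metis
    finally show ?thesis .
  qed
  with x(1) have "x \<in> ?Z" by blast
  obtain K where K: "agree m x (s K)" using x(2) by blast
  have "take m (drop K (w K)) = block (s K) 0 m"
    unfolding s(2) drop_block take_block by (simp add: min_def)
  also have "\<dots> = block x 0 m"
    by (rule agree_block[OF agree_sym[OF K]]) auto
  also have "\<dots> \<in> words ?Z m"
    using \<open>x \<in> ?Z\<close> by (auto simp: words_def intro: block_in_language)
  finally show False using w(3) by blast
qed

text \<open>For a set \<open>L\<close> of words closed under subwords, the exponential growth rate of \<open>L\<close> is at most
  the entropy of the set of points all of whose blocks lie in \<open>L\<close>. This also covers words that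
  cannot be extended within \<open>L\<close>.\<close>

lemma count_growth:
  assumes X: "shift_space X" and L: "L \<subseteq> language X"
    and fac: "\<And>u w v. u @ w @ v \<in> L \<Longrightarrow> w \<in> L"
    and c: "entropy {x\<in>X. \<forall>i n. block x i n \<in> L} < ereal c"
  shows "\<exists>C\<ge>0. \<forall>N. count L N \<le> C * exp (c * real N)"
proof -
  define Z where "Z = {x\<in>X. \<forall>i n. block x i n \<in> L}"
  have Z: "shift_space Z"
    using subsystem_of_language[OF X] by (auto simp: Z_def subsystem_def)
  obtain m where m: "1 \<le> m" "real (card (words Z m)) \<le> exp (c * real m)"
    using entropy_less_words[OF Z] c unfolding Z_def by blast
  obtain K where K: "\<And>w. w \<in> L \<Longrightarrow> length w = K + m + K \<Longrightarrow> take m (drop K w) \<in> words Z m"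
  proof -
    have "\<exists>K. \<forall>w\<in>L. length w = K + m + K \<longrightarrow> take m (drop K w) \<in> words Z m"
      unfolding Z_def by (rule central_subword_of_language[OF X L]) (rule fac)
    then show ?thesis using that by blast
  qed
  have tk: "take n w \<in> L" and dr: "drop n w \<in> L" if "w \<in> L" for n w
    using fac[of "[]" "take n w" "drop n w"] fac[of "take n w" "drop n w" "[]"] that by auto
  \<comment> \<open>Dropping the right margin makes the counts satisfy a recursion: the last \<open>m\<close> letters of a
    longer word then form a word of \<open>Z\<close>.\<close>
  define G where "G j = take (K + j) ` {w\<in>L. length w = 2 * K + j}" for j
  have finG: "finite (G j)" for j
    unfolding G_def using finite_language_length[OF X L] by simp
  have step: "card (G (j + m)) \<le> card (G j) * card (words Z m)" for j
  proof (rule card_le_take_drop[where m = "K + j"])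
    fix v assume "v \<in> G (j + m)"
    then obtain w where w: "w \<in> L" "length w = 2 * K + (j + m)" "v = take (K + (j + m)) w"
      by (auto simp: G_def)
    have "take (K + j) v = take (K + j) (take (2 * K + j) w)"
      using w(3) by (simp add: min_def)
    moreover have "take (2 * K + j) w \<in> {w\<in>L. length w = 2 * K + j}"
      using tk[OF w(1)] w(2) by simp
    ultimately have "take (K + j) v \<in> G j"
      unfolding G_def by blast
    moreover have "drop (K + j) v = take m (drop K (drop j w))"
      using w(3) by (simp add: drop_take)
    moreover have "\<dots> \<in> words Z m"
      using dr[OF w(1)] w(2) by (intro K) auto
    ultimately show "take (K + j) v \<in> G j \<and> drop (K + j) v \<in> words Z m" by simp
  qed (use finG finite_words[OF Z] in auto)
  have "real (card (G (j + m))) \<le> real (card (G j)) * exp (c * real m)" for j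
  proof -
    have "real (card (G (j + m))) \<le> real (card (G j)) * real (card (words Z m))"
      using step[of j] by (simp flip: of_nat_mult)
    also have "\<dots> \<le> real (card (G j)) * exp (c * real m)"
      using m(2) by (intro mult_left_mono) auto
    finally show ?thesis .
  qed
  then obtain C where C: "C \<ge> 0" "\<And>j. real (card (G j)) \<le> C * exp (c * real j)"
    using exp_growth_step[OF m(1), of "\<lambda>j. real (card (G j))" c] by auto
  have "count L (2 * K + j) \<le> (C * real (card (words X K))) * exp (c * real j)" for j
  proof -
    have "card {w\<in>L. length w = 2 * K + j} \<le> card (G j) * card (words X K)"
    proof (rule card_le_take_drop[where m = "K + j"])
      fix w assume w: "w \<in> {w\<in>L. length w = 2 * K + j}"
      then have "take (K + j) w \<in> G j" by (simp add: G_def)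
      moreover have "drop (K + j) w \<in> words X K"
        using w dr[of w "K + j"] L by (auto simp: words_def)
      ultimately show "take (K + j) w \<in> G j \<and> drop (K + j) w \<in> words X K" by simp
    qed (use finG finite_words[OF X] in auto)
    then have "count L (2 * K + j) \<le> real (card (G j)) * real (card (words X K))"
      by (simp add: count_def flip: of_nat_mult)
    also have "\<dots> \<le> (C * exp (c * real j)) * real (card (words X K))"
      using C(2) by (intro mult_right_mono) auto
    finally show ?thesis by (simp add: mult_ac)
  qed
  then show ?thesis by (intro exp_growth_tail) auto
qed

lemma words_growth:
  assumes X: "shift_space X" and c: "entropy X < ereal c"
  shows "\<exists>C\<ge>0. \<forall>N. real (card (words X N)) \<le> C * exp (c * real N)"
proof -
  have "{x\<in>X. \<forall>i n. block x i n \<in> language X} = X" by (auto intro: block_in_language)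
  then have "\<exists>C\<ge>0. \<forall>N. count (language X) N \<le> C * exp (c * real N)"
    using c by (intro count_growth[OF X order_refl]) (auto intro: language_subword)
  then show ?thesis by (simp add: count_language)
qed

text \<open>Entropy only sees the number of words up to a subexponential factor and a bounded change of
  length.\<close>

lemma entropy_mono_words:
  assumes X: "shift_space X" and Z: "shift_space Z"
    and cmp: "\<And>\<epsilon>. 0 < \<epsilon> \<Longrightarrow> \<exists>C\<ge>0. \<exists>d. \<forall>n. real (card (words X n)) \<le>
      C * exp (\<epsilon> * real n) * real (card (words Z (n + d)))"
  shows "entropy X \<le> entropy Z"
proof (cases "X = {}")
  case True
  then show ?thesis by (simp add: entropy_def)
next
  case False
  then obtain h where h: "entropy X = ereal h"
    "\<And>n. exp (h * real n) \<le> real (card (words X n))"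
    using entropy_eq[OF X] by metis
  show ?thesis
  proof (rule ccontr)
    assume "\<not> entropy X \<le> entropy Z"
    then obtain c where c: "entropy Z < ereal c" "c < h"
      using ereal_dense2[of "entropy Z" "ereal h"] h(1) by (auto simp: not_le)
    define \<epsilon> where "\<epsilon> = (h - c) / 2"
    have "0 < \<epsilon>" using c(2) by (simp add: \<epsilon>_def)
    then obtain C d where C: "0 \<le> C" "\<And>n. real (card (words X n)) \<le>
        C * exp (\<epsilon> * real n) * real (card (words Z (n + d)))"
      using cmp by blast
    obtain D where D: "0 \<le> D" "\<And>n. real (card (words Z n)) \<le> D * exp (c * real n)"
      using words_growth[OF Z c(1)] by blast
    have "exp (h * real n) \<le> (C * D * exp (c * real d)) * real (n + 1) * exp ((c + \<epsilon>) * real n)" for n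
    proof -
      have "exp (h * real n) \<le> C * exp (\<epsilon> * real n) * real (card (words Z (n + d)))"
        using h(2)[of n] C(2)[of n] by linarith
      also have "\<dots> \<le> C * exp (\<epsilon> * real n) * (D * exp (c * real (n + d)))"
        using C(1) by (intro mult_left_mono D(2)) auto
      also have "\<dots> = (C * D * exp (c * real d)) * exp ((c + \<epsilon>) * real n)"
        by (simp add: exp_add algebra_simps)
      also have "\<dots> \<le> (C * D * exp (c * real d)) * real (n + 1) * exp ((c + \<epsilon>) * real n)"
        using C(1) D(1) mult_left_mono[of 1 "real (n + 1)" "C * D * exp (c * real d)"]
        by (intro mult_right_mono) auto
      finally show ?thesis .
    qed
    then have "h \<le> c + \<epsilon>" by (rule exp_growth_compare)
    then show False using c(2) by (simp add: \<epsilon>_def field_simps)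
  qed
qed

section \<open>Irreducibility of entropy-minimal shift spaces\<close>

text \<open>The word \<open>w\<close> has no subword \<open>u\<close>.\<close>

definition avoids :: "'a list \<Rightarrow> 'a list \<Rightarrow> bool" where
  "avoids u w \<longleftrightarrow> (\<nexists>p s. w = p @ u @ s)"

lemma avoids_subword: "avoids u (p @ w @ s) \<Longrightarrow> avoids u w"
  unfolding avoids_def by (metis append.assoc)

lemma avoiding_subsystem_entropy:
  assumes X: "shift_space X" and min: "\<And>Z. subsystem Z X \<Longrightarrow> Z \<noteq> X \<Longrightarrow> entropy Z < entropy X"
    and u: "u \<in> language X"
  shows "entropy {x\<in>X. \<forall>i n. block x i n \<in> {w\<in>language X. avoids u w}} < entropy X"
proof (rule min[OF subsystem_of_language[OF X]])
  obtain x where x: "x \<in> X" "u = block x 0 (length u)" by (rule languageE[OF X u])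
  have "\<not> avoids u (block x 0 (length u))"
    unfolding avoids_def using x(2) by (metis append_Nil append_Nil2)
  with x(1) show "{x\<in>X. \<forall>i n. block x i n \<in> {w\<in>language X. avoids u w}} \<noteq> X" by blast
qed

text \<open>If no word of the language has an occurrence of \<open>u\<close> followed by a disjoint occurrence of
  \<open>v\<close>, then each word is a word without \<open>u\<close> followed by a word without \<open>e # v\<close>. The cut is
  placed just before the last letter of the first occurrence of \<open>u\<close>. The extra letter \<open>e\<close>
  absorbs that last letter of \<open>u\<close>, which belongs to the second word.\<close>

lemma split_avoiding:
  assumes w: "w \<in> language X" and u: "u \<noteq> []"
    and gap: "\<And>g. u @ g @ v \<notin> language X"
  shows "\<exists>j\<le>length w. avoids u (take j w) \<and> avoids (e # v) (drop j w)"
proof (cases "avoids u w")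
  case True
  then show ?thesis by (intro exI[of _ "length w"]) (auto simp: avoids_def)
next
  case False
  define P where "P j \<longleftrightarrow> \<not> avoids u (take j w)" for j
  define j where "j = (LEAST j. P j)"
  have P: "P (length w)" using False by (simp add: P_def)
  have Pj: "P j" unfolding j_def using P by (rule LeastI)
  have jle: "j \<le> length w" unfolding j_def using P by (rule Least_le)
  have "\<not> P 0" using u by (simp add: P_def avoids_def)
  with Pj obtain i where i: "j = Suc i" by (cases j) auto
  have "\<not> P i" using not_less_Least[of i P] i by (simp add: j_def)
  then have ai: "avoids u (take i w)" by (simp add: P_def)
  obtain p s where ps: "take j w = p @ u @ s" using Pj by (auto simp: P_def avoids_def)
  have "s = []"
  proof (rule ccontr)
    assume "s \<noteq> []"
    have "take i w = butlast (take j w)"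
      using jle i by (simp add: butlast_take)
    also have "\<dots> = p @ u @ butlast s"
      using \<open>s \<noteq> []\<close> by (simp add: ps butlast_append)
    finally show False using ai by (auto simp: avoids_def)
  qed
  have "avoids (e # v) (drop i w)"
    unfolding avoids_def
  proof (intro notI, elim exE)
    fix q r assume q: "drop i w = q @ (e # v) @ r"
    have "drop j w = tl (drop i w)" using i by (simp add: drop_Suc tl_drop)
    also have "\<dots> = tl (q @ [e]) @ v @ r" unfolding q by (cases q) auto
    finally have "w = p @ (u @ tl (q @ [e]) @ v) @ r"
      using append_take_drop_id[of j w] ps \<open>s = []\<close> by simp
    then have "u @ tl (q @ [e]) @ v \<in> language X"
      using w language_subword by blast
    with gap show False by blast
  qed
  with ai jle i show ?thesis by (intro exI[of _ i]) auto
qed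

text \<open>Otherwise every word is cut into two words of strictly smaller growth rate. There are only
  linearly many places to cut, so the growth rate of the whole language would be smaller than the
  entropy of the shift space.\<close>

lemma entropy_minimal_imp_irreducible:
  assumes X: "shift_space X" and min: "\<And>Z. subsystem Z X \<Longrightarrow> Z \<noteq> X \<Longrightarrow> entropy Z < entropy X"
  shows "irreducible_shift X"
proof (rule ccontr)
  assume "\<not> irreducible_shift X"
  then obtain u v where uv: "u \<in> language X" "v \<in> language X" "\<And>g. u @ g @ v \<notin> language X"
    unfolding irreducible_shift_def by blast
  have u: "u \<noteq> []" using uv(2) uv(3)[of "[]"] by auto
  obtain x where x: "x \<in> X" "v = block x 0 (length v)" by (rule languageE[OF X uv(2)])
  \<comment> \<open>A letter preceding \<open>v\<close> in some point, so that \<open>e # v\<close> is in the language as well.\<close>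
  define e where "e = x (-1)"
  have "e # v = block x (-1) (1 + length v)"
    unfolding block_append using x(2) by (simp add: e_def block_def)
  then have ev: "e # v \<in> language X" using x(1) by (metis block_in_language)
  define L where "L u = {w\<in>language X. avoids u w}" for u
  have L: "L u \<subseteq> language X" "a @ w @ b \<in> L u \<Longrightarrow> w \<in> L u" for a b w u
    unfolding L_def using avoids_subword[of u a w b] language_subword[of a w b X] by auto
  define Z where "Z u = {x\<in>X. \<forall>i n. block x i n \<in> L u}" for u
  have Zless: "entropy (Z u) < entropy X" if "u \<in> language X" for u
    using avoiding_subsystem_entropy[OF X min that] unfolding Z_def L_def .
  obtain h where h: "entropy X = ereal h" "\<And>n. exp (h * real n) \<le> real (card (words X n))"
    using entropy_eq[OF X] x(1) by (metis empty_iff)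
  have "max (entropy (Z u)) (entropy (Z (e # v))) < ereal h"
    using Zless[OF uv(1)] Zless[OF ev] h(1) by simp
  then obtain c where c: "max (entropy (Z u)) (entropy (Z (e # v))) < ereal c" "c < h"
    using ereal_dense2 by (metis less_ereal.simps(1))
  have "\<exists>C\<ge>0. \<forall>N. count (L u') N \<le> C * exp (c * real N)" if "entropy (Z u') < ereal c" for u'
    using that unfolding Z_def by (rule count_growth[OF X L(1), rotated]) (rule L(2))
  then obtain C D where C: "0 \<le> C" "\<And>N. count (L u) N \<le> C * exp (c * real N)"
    and D: "0 \<le> D" "\<And>N. count (L (e # v)) N \<le> D * exp (c * real N)"
    using c(1) by (metis max_less_iff_conj)
  have fin: "finite {w\<in>L u. length w = n}" for u n
    using finite_language_length[OF X L(1)] .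
  have "exp (h * real N) \<le> (C * D) * real (N + 1) * exp (c * real N)" for N
  proof -
    define S where "S j = {w\<in>words X N. take j w \<in> L u \<and> drop j w \<in> L (e # v)}" for j
    have S: "real (card (S j)) \<le> C * D * exp (c * real N)" if "j \<in> {..N}" for j
    proof -
      have "card (S j) \<le> card {w\<in>L u. length w = j} * card {w\<in>L (e # v). length w = N - j}"
        using that by (intro card_le_take_drop[where m = j] fin) (auto simp: S_def words_def)
      then have "real (card (S j)) \<le> count (L u) j * count (L (e # v)) (N - j)"
        by (simp add: count_def flip: of_nat_mult)
      also have "\<dots> \<le> (C * exp (c * real j)) * (D * exp (c * real (N - j)))"
        using C D by (intro mult_mono) auto
      also have "\<dots> = C * D * exp (c * real N)"
        using that by (simp add: of_nat_diff algebra_simps flip: exp_add)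
      finally show ?thesis .
    qed
    have "words X N \<subseteq> (\<Union>j\<in>{..N}. S j)"
    proof
      fix w assume w: "w \<in> words X N"
      then have wl: "w \<in> language X" "length w = N" by (auto simp: words_def)
      then obtain j where j: "j \<le> N" "avoids u (take j w)" "avoids (e # v) (drop j w)"
        using split_avoiding[OF wl(1) u uv(3)] by blast
      moreover have "take j w \<in> language X" "drop j w \<in> language X"
        using wl(1) language_appendD[of "take j w" "drop j w"] by auto
      ultimately show "w \<in> (\<Union>j\<in>{..N}. S j)" using w by (auto simp: S_def L_def)
    qed
    then have "card (words X N) \<le> card (\<Union>j\<in>{..N}. S j)"
      using finite_words[OF X] by (intro card_mono) (auto simp: S_def)
    also have "\<dots> \<le> (\<Sum>j\<in>{..N}. card (S j))" by (rule card_UN_le) simp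
    finally have "real (card (words X N)) \<le> (\<Sum>j\<in>{..N}. real (card (S j)))"
      by (simp flip: of_nat_sum)
    also have "\<dots> \<le> (\<Sum>j\<in>{..N}. C * D * exp (c * real N))" by (intro sum_mono S)
    also have "\<dots> = (C * D) * real (N + 1) * exp (c * real N)" by simp
    finally show ?thesis using h(2)[of N] by linarith
  qed
  then have "h \<le> c" by (rule exp_growth_compare)
  with c(2) show False by simp
qed

section \<open>Codes as sliding block maps\<close>

lemma code_translate:
  assumes X: "shift_space X" and \<phi>: "code X Y \<phi>" and x: "x \<in> X"
  shows "\<phi> (translate t x) = translate t (\<phi> x)"
proof -
  have fw: "\<phi> (translate 1 x) = translate 1 (\<phi> x)" if "x \<in> X" for x
    using \<phi> that by (simp add: code_def shift_map_eq)
  have nat: "\<phi> (translate (int n) x) = translate (int n) (\<phi> x)" if "x \<in> X" for n x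
  proof (induction n)
    case (Suc n)
    have "\<phi> (translate 1 (translate (int n) x)) = translate 1 (\<phi> (translate (int n) x))"
      using shift_space_translate[OF X that] by (intro fw)
    with Suc show ?case by simp
  qed simp
  show ?thesis
  proof (cases t rule: int_cases2)
    case (nonneg n)
    then show ?thesis using nat[OF x] by simp
  next
    case (nonpos n)
    have "\<phi> (translate (int n) (translate t x)) = translate (int n) (\<phi> (translate t x))"
      using nat[OF shift_space_translate[OF X x]] .
    then have "\<phi> x = translate (int n) (\<phi> (translate t x))" using nonpos by simp
    then show ?thesis using nonpos by simp
  qed
qed

text \<open>The theorem of Curtis, Hedlund and Lyndon: a code is given by a sliding block map.\<close>

lemma code_window:
  assumes X: "shift_space X" and \<phi>: "code X Y \<phi>"
  shows "\<exists>r. \<forall>k. \<forall>x\<in>X. \<forall>x'\<in>X. agree (k + r) x x' \<longrightarrow> agree k (\<phi> x) (\<phi> x')"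
proof -
  have "\<exists>r. \<forall>x\<in>X. \<forall>x'\<in>X. agree r x x' \<longrightarrow> \<phi> x 0 = \<phi> x' 0"
  proof (rule ccontr)
    assume "\<not> ?thesis"
    then have "\<forall>r. \<exists>p. fst p \<in> X \<and> snd p \<in> X \<and> agree r (fst p) (snd p) \<and> \<phi> (fst p) 0 \<noteq> \<phi> (snd p) 0"
      by fastforce
    from choice[OF this] obtain p where p: "\<And>r. fst (p r) \<in> X" "\<And>r. snd (p r) \<in> X"
      "\<And>r. agree r (fst (p r)) (snd (p r))" "\<And>r. \<phi> (fst (p r)) 0 \<noteq> \<phi> (snd (p r)) 0" by blast
    obtain x where x: "x \<in> X" "\<And>k N. \<exists>n\<ge>N. agree k x (fst (p n))"
      using cluster_point[of X "\<lambda>n. fst (p n)", OF X p(1)] by blast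
    obtain l where l: "\<And>x'. x' \<in> X \<Longrightarrow> agree l x x' \<Longrightarrow> agree 0 (\<phi> x) (\<phi> x')"
      using continuous_map_seq_top[of X Y \<phi> x 0] \<phi> x(1) unfolding code_def by blast
    obtain n where n: "n \<ge> l" "agree l x (fst (p n))" using x(2) by blast
    have "agree l x (snd (p n))"
      by (rule agree_trans[OF n(2) agree_mono[OF p(3) n(1)]])
    then have "agree 0 (\<phi> x) (\<phi> (fst (p n)))" "agree 0 (\<phi> x) (\<phi> (snd (p n)))"
      using l p n(2) by blast+
    then show False using p(4)[of n] by (simp add: agree_def)
  qed
  then obtain r where r: "\<And>x x'. x \<in> X \<Longrightarrow> x' \<in> X \<Longrightarrow> agree r x x' \<Longrightarrow> \<phi> x 0 = \<phi> x' 0" by blast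
  have "agree k (\<phi> x) (\<phi> x')" if x: "x \<in> X" "x' \<in> X" and a: "agree (k + r) x x'" for k x x'
    unfolding agree_def
  proof
    fix i assume i: "i \<in> {- int k..int k}"
    have "agree r (translate i x) (translate i x')"
      unfolding agree_def translate_apply using i by (intro ballI agreeD[OF a]) auto
    then have "\<phi> (translate i x) 0 = \<phi> (translate i x') 0"
      using x shift_space_translate[OF X] by (intro r) auto
    then show "\<phi> x i = \<phi> x' i"
      using code_translate[OF X \<phi>] x by (simp add: translate_apply)
  qed
  then show ?thesis by blast
qed

text \<open>Continuity at a cluster point of a sequence whose images converge to \<open>y\<close>.\<close>

lemma code_cluster:
  assumes X: "shift_space X" and \<phi>: "code X Y \<phi>"
    and s: "\<And>k. s k \<in> X" "\<And>k. agree k (\<phi> (s k)) y" and x: "x \<in> X" "\<And>k N. \<exists>n\<ge>N. agree k x (s n)"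
  shows "\<phi> x = y"
proof (rule agree_all_eq)
  fix k
  obtain r where r: "\<And>k x x'. x \<in> X \<Longrightarrow> x' \<in> X \<Longrightarrow> agree (k + r) x x' \<Longrightarrow> agree k (\<phi> x) (\<phi> x')"
    using code_window[OF X \<phi>] by blast
  obtain n where n: "n \<ge> k" "agree (k + r) x (s n)" using x(2) by blast
  have "agree k (\<phi> x) (\<phi> (s n))" using r[OF x(1) s(1) n(2)] .
  then show "agree k (\<phi> x) y" using agree_mono[OF s(2) n(1)] by (rule agree_trans)
qed

section \<open>Entropy under factor codes\<close>

lemma factor_entropy_le:
  assumes Z: "shift_space Z" and Y: "shift_space Y" and \<phi>: "code Z Y \<phi>" and onto: "\<phi> ` Z = Y"
  shows "entropy Y \<le> entropy Z"
proof (rule entropy_mono_words[OF Y Z])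
  fix \<epsilon> :: real assume \<epsilon>: "0 < \<epsilon>"
  obtain r where r: "\<And>k x x'. x \<in> Z \<Longrightarrow> x' \<in> Z \<Longrightarrow> agree (k + r) x x' \<Longrightarrow> agree k (\<phi> x) (\<phi> x')"
    using code_window[OF Z \<phi>] by blast
  have "card (words Y n) \<le> card (words Z (n + 2 * r))" for n
  proof -
    have "\<forall>v\<in>words Y n. \<exists>z. z \<in> Z \<and> v = block (\<phi> z) 0 n"
      unfolding words_eq[OF Y, where i = 0] using onto by blast
    from bchoice[OF this] obtain f where f: "\<And>v. v \<in> words Y n \<Longrightarrow> f v \<in> Z"
      "\<And>v. v \<in> words Y n \<Longrightarrow> v = block (\<phi> (f v)) 0 n" by blast
    define g where "g v = block (f v) (- int r) (n + 2 * r)" for v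
    have "inj_on g (words Y n)"
    proof (rule inj_onI)
      fix v v' assume v: "v \<in> words Y n" "v' \<in> words Y n" "g v = g v'"
      have "block (\<phi> (f v)) 0 n = block (\<phi> (f v')) 0 n"
      proof (rule block_cong)
        fix i :: int assume i: "0 \<le> i" "i < 0 + int n"
        have "agree r (translate i (f v)) (translate i (f v'))"
          unfolding agree_def translate_apply
          using i v(3)[unfolded g_def] by (auto intro!: block_eqD[of "f v" "- int r" "n + 2 * r" "f v'"])
        then have "agree 0 (\<phi> (translate i (f v))) (\<phi> (translate i (f v')))"
          using f v shift_space_translate[OF Z] by (intro r) auto
        then show "\<phi> (f v) i = \<phi> (f v') i"
          using code_translate[OF Z \<phi>] f v by (simp add: translate_apply agree_def)
      qed
      then show "v = v'" using f(2) v by metis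
    qed
    moreover have "g ` words Y n \<subseteq> words Z (n + 2 * r)"
      using f by (auto simp: g_def words_def intro: block_in_language)
    ultimately show ?thesis using finite_words[OF Z] by (rule card_inj_on_le)
  qed
  then have "real (card (words Y n)) \<le> 1 * exp (\<epsilon> * real n) * real (card (words Z (n + 2 * r)))" for n
    using mult_mono[of 1 "exp (\<epsilon> * real n)" "real (card (words Y n))" "real (card (words Z (n + 2 * r)))"] \<epsilon>
    by simp
  then show "\<exists>C\<ge>0. \<exists>d. \<forall>n. real (card (words Y n)) \<le>
      C * exp (\<epsilon> * real n) * real (card (words Z (n + d)))"
    by (intro exI[of _ 1] conjI exI[of _ "2 * r"]) auto
qed

lemma code_restrict:
  assumes "code X Y \<phi>" "Z \<subseteq> X"
  shows "code Z Y \<phi>"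
proof -
  have "continuous_map (subtopology (seq_top X) Z) (seq_top Y) \<phi>"
    using assms(1) by (auto simp: code_def intro: continuous_map_from_subtopology)
  moreover have "subtopology (seq_top X) Z = seq_top Z"
    using assms(2) by (simp add: seq_top_def subtopology_subtopology inf.absorb2)
  ultimately show ?thesis using assms by (auto simp: code_def)
qed

text \<open>The words in the coordinates \<open>[0, n)\<close> of those points whose image agrees with \<open>y\<close> on the
  window \<open>[- W, b + W]\<close>.\<close>

definition lifts :: "(int \<Rightarrow> 'a) set \<Rightarrow> ((int \<Rightarrow> 'a) \<Rightarrow> int \<Rightarrow> 'b) \<Rightarrow> nat \<Rightarrow> (int \<Rightarrow> 'b) \<Rightarrow> nat \<Rightarrow> nat \<Rightarrow> 'a list set" where
  "lifts X \<phi> W y b n = {block x 0 n | x. x \<in> X \<and> (\<forall>i\<in>{- int W..int b + int W}. \<phi> x i = y i)}"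

lemma lifts_subset_words: "lifts X \<phi> W y b n \<subseteq> words X n"
  by (auto simp: lifts_def words_def intro: block_in_language)

lemma lifts_0: "lifts X \<phi> W y 0 n = {block x 0 n | x. x \<in> X \<and> agree W (\<phi> x) y}"
  by (auto simp: lifts_def agree_def)

text \<open>A finite fibre is small compared with \<open>exp (\<epsilon> * n)\<close> for suitable \<open>n\<close>, and by compactness
  a point whose image is close enough to \<open>y\<close> has the same block \<open>[0, n)\<close> as a point of the fibre.\<close>

lemma finite_fibre_few_lifts:
  assumes X: "shift_space X" and \<phi>: "code X Y \<phi>"
    and fin: "finite {x\<in>X. \<phi> x = y}" and \<epsilon>: "0 < \<epsilon>"
  shows "\<exists>n W. 1 \<le> n \<and> real (card (lifts X \<phi> W y 0 n)) \<le> exp (\<epsilon> * real n)"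
proof -
  define F where "F = {x\<in>X. \<phi> x = y}"
  obtain n :: nat where n: "real (card F) / \<epsilon> + 1 < real n" using reals_Archimedean2 by blast
  have "0 \<le> real (card F) / \<epsilon>" using \<epsilon> by simp
  then have n1: "1 \<le> n" using n by linarith
  have "real (card F) / \<epsilon> \<le> real n" using n by linarith
  then have "real (card F) \<le> \<epsilon> * real n" using \<epsilon> by (simp add: field_simps)
  also have "\<dots> \<le> exp (\<epsilon> * real n)" using exp_ge_add_one_self[of "\<epsilon> * real n"] by linarith
  finally have cardF: "real (card F) \<le> exp (\<epsilon> * real n)" .
  have "\<exists>W. \<forall>x\<in>X. agree W (\<phi> x) y \<longrightarrow> (\<exists>z\<in>F. agree n x z)"
  proof (rule ccontr)
    assume "\<not> ?thesis"
    then have "\<forall>W. \<exists>x. x \<in> X \<and> agree W (\<phi> x) y \<and> (\<forall>z\<in>F. \<not> agree n x z)" by blast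
    from choice[OF this] obtain s where s: "\<And>W. s W \<in> X" "\<And>W. agree W (\<phi> (s W)) y"
      "\<And>W z. z \<in> F \<Longrightarrow> \<not> agree n (s W) z" by blast
    obtain x where x: "x \<in> X" "\<And>k N. \<exists>n\<ge>N. agree k x (s n)"
      using cluster_point[of X s, OF X s(1)] by blast
    have "\<phi> x = y" by (rule code_cluster[OF X \<phi> s(1,2) x])
    then have "x \<in> F" using x(1) by (simp add: F_def)
    with s(3) x(2) agree_sym show False by blast
  qed
  then obtain W where W: "\<And>x. x \<in> X \<Longrightarrow> agree W (\<phi> x) y \<Longrightarrow> \<exists>z\<in>F. agree n x z" by blast
  have "lifts X \<phi> W y 0 n \<subseteq> (\<lambda>z. block z 0 n) ` F"
  proof
    fix w assume "w \<in> lifts X \<phi> W y 0 n"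
    then obtain x where x: "x \<in> X" "w = block x 0 n" "agree W (\<phi> x) y" by (auto simp: lifts_0)
    obtain z where "z \<in> F" "agree n x z" using W[OF x(1,3)] by blast
    then show "w \<in> (\<lambda>z. block z 0 n) ` F"
      using agree_block[of n x z 0 n] x(2) by auto
  qed
  moreover have "finite F" using fin by (simp add: F_def)
  ultimately have "card (lifts X \<phi> W y 0 n) \<le> card F"
    by (meson card_image_le card_mono finite_imageI order_trans)
  with cardF n1 show ?thesis by (intro exI[of _ n] exI[of _ W]) auto
qed

text \<open>The length \<open>n\<close> depends on \<open>y\<close>, since the fibres need not be bounded in size, but by
  compactness of \<open>Y\<close> it can be bounded.\<close>

lemma uniformly_few_lifts:
  assumes X: "shift_space X" and Y: "shift_space Y" and \<phi>: "code X Y \<phi>"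
    and fin: "finite_to_one X Y \<phi>" and \<epsilon>: "0 < \<epsilon>"
  shows "\<exists>W. \<forall>y\<in>Y. \<exists>n. 1 \<le> n \<and> n \<le> W \<and> real (card (lifts X \<phi> W y 0 n)) \<le> exp (\<epsilon> * real n)"
proof (rule ccontr)
  assume "\<not> ?thesis"
  then have "\<forall>W. \<exists>y. y \<in> Y \<and> (\<forall>n. 1 \<le> n \<and> n \<le> W \<longrightarrow> \<not> real (card (lifts X \<phi> W y 0 n)) \<le> exp (\<epsilon> * real n))"
    by blast
  from choice[OF this] obtain s where s: "\<And>W. s W \<in> Y"
    "\<And>W n. 1 \<le> n \<Longrightarrow> n \<le> W \<Longrightarrow> \<not> real (card (lifts X \<phi> W (s W) 0 n)) \<le> exp (\<epsilon> * real n)" by blast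
  obtain y where y: "y \<in> Y" "\<And>k N. \<exists>n\<ge>N. agree k y (s n)"
    using cluster_point[of Y s, OF Y s(1)] by blast
  obtain n V where n: "1 \<le> n" "real (card (lifts X \<phi> V y 0 n)) \<le> exp (\<epsilon> * real n)"
    using finite_fibre_few_lifts[OF X \<phi> _ \<epsilon>] fin y(1) unfolding finite_to_one_def by blast
  obtain W where W: "W \<ge> max n V" "agree V y (s W)" using y(2) by blast
  have "lifts X \<phi> W (s W) 0 n \<subseteq> lifts X \<phi> V y 0 n"
    unfolding lifts_0 using W agree_mono[of W _ "s W" V] agree_trans[OF _ agree_sym[OF W(2)]] by fastforce
  then have "card (lifts X \<phi> W (s W) 0 n) \<le> card (lifts X \<phi> V y 0 n)"
    using finite_subset[OF lifts_subset_words finite_words[OF X]] by (intro card_mono)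
  with n s(2)[of n W] W(1) show False by simp
qed

text \<open>A long window is cut into pieces whose lengths are chosen one after the other, each by
  the translate of \<open>y\<close> reached so far.\<close>

lemma lifts_growth:
  assumes X: "shift_space X" and Y: "shift_space Y" and \<phi>: "code X Y \<phi>"
    and few: "\<And>y. y \<in> Y \<Longrightarrow> \<exists>n. 1 \<le> n \<and> n \<le> W \<and> real (card (lifts X \<phi> W y 0 n)) \<le> exp (\<epsilon> * real n)"
    and \<epsilon>: "0 < \<epsilon>" and y: "y \<in> Y"
  shows "real (card (lifts X \<phi> W y N N)) \<le> (\<Sum>j\<le>W. real (card (words X j))) * exp (\<epsilon> * real N)"
  using y
proof (induction N arbitrary: y rule: less_induct)
  case (less N)
  let ?D = "\<Sum>j\<le>W. real (card (words X j))"
  have finl: "finite (lifts X \<phi> W y b n)" for y b n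
    using finite_subset[OF lifts_subset_words finite_words[OF X]] .
  show ?case
  proof (cases "N \<le> W")
    case True
    have "real (card (lifts X \<phi> W y N N)) \<le> real (card (words X N))"
      using card_mono[OF finite_words[OF X] lifts_subset_words] by simp
    also have "\<dots> \<le> ?D"
      using True by (intro member_le_sum[where f = "\<lambda>j. real (card (words X j))"]) auto
    also have "\<dots> = ?D * 1" by simp
    also have "\<dots> \<le> ?D * exp (\<epsilon> * real N)"
      using \<epsilon> by (intro mult_left_mono) (auto intro: sum_nonneg)
    finally show ?thesis .
  next
    case False
    obtain n where n: "1 \<le> n" "n \<le> W" "real (card (lifts X \<phi> W y 0 n)) \<le> exp (\<epsilon> * real n)"
      using few less.prems by blast
    let ?y = "translate (int n) y"
    have "card (lifts X \<phi> W y N N) \<le> card (lifts X \<phi> W y 0 n) * card (lifts X \<phi> W ?y (N - n) (N - n))"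
    proof (rule card_le_take_drop[where m = n])
      fix w assume "w \<in> lifts X \<phi> W y N N"
      then obtain x where x: "x \<in> X" "\<And>i. i \<in> {- int W..int N + int W} \<Longrightarrow> \<phi> x i = y i" "w = block x 0 N"
        by (auto simp: lifts_def)
      have "take n w \<in> lifts X \<phi> W y 0 n"
        unfolding lifts_def x(3) take_block using x(1,2) n(2) False
        by (auto intro!: exI[of _ x] simp: min_def)
      moreover have "drop n w = block (translate (int n) x) 0 (N - n)"
        unfolding x(3) drop_block block_translate by simp
      moreover have "\<forall>i\<in>{- int W..int (N - n) + int W}. \<phi> (translate (int n) x) i = ?y i"
        using x(2) n(2) False by (auto simp: code_translate[OF X \<phi> x(1)] translate_apply of_nat_diff)
      ultimately show "take n w \<in> lifts X \<phi> W y 0 n \<and> drop n w \<in> lifts X \<phi> W ?y (N - n) (N - n)"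
        using shift_space_translate[OF X x(1)] unfolding lifts_def by blast
    qed (rule finl)+
    then have "real (card (lifts X \<phi> W y N N)) \<le>
        real (card (lifts X \<phi> W y 0 n)) * real (card (lifts X \<phi> W ?y (N - n) (N - n)))"
      by (simp flip: of_nat_mult)
    also have "\<dots> \<le> exp (\<epsilon> * real n) * (?D * exp (\<epsilon> * real (N - n)))"
      using n False less.IH[of "N - n" ?y] shift_space_translate[OF Y less.prems]
      by (intro mult_mono) auto
    also have "\<dots> = ?D * exp (\<epsilon> * real N)"
      using n False by (simp add: of_nat_diff algebra_simps flip: exp_add)
    finally show ?thesis .
  qed
qed

text \<open>The case of finite fibres of Bowen's inequality.\<close>

lemma finite_to_one_entropy_le:
  assumes X: "shift_space X" and Y: "shift_space Y" and \<phi>: "code X Y \<phi>" and onto: "\<phi> ` X = Y"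
    and fin: "finite_to_one X Y \<phi>"
  shows "entropy X \<le> entropy Y"
proof (rule entropy_mono_words[OF X Y])
  fix \<epsilon> :: real assume \<epsilon>: "0 < \<epsilon>"
  obtain W where W: "\<And>y. y \<in> Y \<Longrightarrow> \<exists>n. 1 \<le> n \<and> n \<le> W \<and> real (card (lifts X \<phi> W y 0 n)) \<le> exp (\<epsilon> * real n)"
    using uniformly_few_lifts[OF X Y \<phi> fin \<epsilon>] by blast
  define D where "D = (\<Sum>j\<le>W. real (card (words X j)))"
  have "real (card (words X N)) \<le> D * exp (\<epsilon> * real N) * real (card (words Y (N + (2 * W + 1))))" for N
  proof -
    let ?V = "words Y (N + (2 * W + 1))"
    define S where "S v = {block x 0 N | x. x \<in> X \<and> block (\<phi> x) (- int W) (N + (2 * W + 1)) = v}" for v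
    have S: "real (card (S v)) \<le> D * exp (\<epsilon> * real N)" if v: "v \<in> ?V" for v
    proof -
      obtain y where y: "y \<in> Y" "v = block y (- int W) (length v)"
        using languageE[OF Y] v unfolding words_def by blast
      have "length v = N + (2 * W + 1)" using v by (simp add: words_def)
      have "S v \<subseteq> lifts X \<phi> W y N N"
      proof
        fix w assume "w \<in> S v"
        then obtain x where x: "x \<in> X" "w = block x 0 N"
          "block (\<phi> x) (- int W) (N + (2 * W + 1)) = block y (- int W) (N + (2 * W + 1))"
          using y(2) \<open>length v = _\<close> by (auto simp: S_def)
        have "\<forall>i\<in>{- int W..int N + int W}. \<phi> x i = y i"
          by (intro ballI block_eqD[OF x(3)]) auto
        with x(1,2) show "w \<in> lifts X \<phi> W y N N" unfolding lifts_def by blast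
      qed
      then have "real (card (S v)) \<le> real (card (lifts X \<phi> W y N N))"
        using finite_subset[OF lifts_subset_words finite_words[OF X], of \<phi> W y N N] by (simp add: card_mono)
      also have "\<dots> \<le> D * exp (\<epsilon> * real N)"
        unfolding D_def by (rule lifts_growth[OF X Y \<phi> W \<epsilon> y(1)])
      finally show ?thesis .
    qed
    have "words X N \<subseteq> (\<Union>v\<in>?V. S v)"
    proof
      fix w assume "w \<in> words X N"
      then obtain x where x: "x \<in> X" "w = block x 0 N" unfolding words_eq[OF X, where i = 0] by blast
      have "\<phi> x \<in> Y" using x(1) onto by blast
      then have "block (\<phi> x) (- int W) (N + (2 * W + 1)) \<in> ?V"
        unfolding words_def by (simp add: block_in_language)
      with x show "w \<in> (\<Union>v\<in>?V. S v)" unfolding S_def by blast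
    qed
    moreover have "finite (\<Union>v\<in>?V. S v)"
    proof (rule finite_subset)
      show "(\<Union>v\<in>?V. S v) \<subseteq> words X N" unfolding words_eq[OF X, where i = 0] S_def by auto
    qed (rule finite_words[OF X])
    ultimately have "card (words X N) \<le> card (\<Union>v\<in>?V. S v)" by (intro card_mono)
    also have "\<dots> \<le> (\<Sum>v\<in>?V. card (S v))" by (rule card_UN_le[OF finite_words[OF Y]])
    finally have "real (card (words X N)) \<le> (\<Sum>v\<in>?V. real (card (S v)))"
      by (simp flip: of_nat_sum)
    also have "\<dots> \<le> (\<Sum>v\<in>?V. D * exp (\<epsilon> * real N))" by (intro sum_mono S)
    also have "\<dots> = D * exp (\<epsilon> * real N) * real (card ?V)" by simp
    finally show ?thesis .
  qed
  moreover have "0 \<le> D" by (simp add: D_def sum_nonneg)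
  ultimately show "\<exists>C\<ge>0. \<exists>d. \<forall>n. real (card (words X n)) \<le>
      C * exp (\<epsilon> * real n) * real (card (words Y (n + d)))" by blast
qed

section \<open>Points over right transitive points\<close>

text \<open>The points that are approximated by translates of \<open>x\<close> by arbitrarily large positive amounts.\<close>

definition omega_limit :: "(int \<Rightarrow> 'a) \<Rightarrow> (int \<Rightarrow> 'a) set" where
  "omega_limit x = {z. \<forall>k N. \<exists>i\<ge>int N. agree k z (translate i x)}"

lemma subsystem_omega_limit:
  assumes X: "shift_space X" and x: "x \<in> X"
  shows "subsystem (omega_limit x) X"
proof (rule subsystemI[OF X])
  show "omega_limit x \<subseteq> X"
  proof
    fix z assume "z \<in> omega_limit x"
    then have "\<exists>c\<in>X. agree k z c" for k
      unfolding omega_limit_def using shift_space_translate[OF X x] by blast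
    then show "z \<in> X" by (rule shift_space_closed[OF X])
  qed
  fix t z assume z: "z \<in> omega_limit x"
  show "translate t z \<in> omega_limit x"
    unfolding omega_limit_def
  proof (intro CollectI allI)
    fix k N
    obtain i where i: "i \<ge> int (N + nat \<bar>t\<bar>)" "agree (k + nat \<bar>t\<bar>) z (translate i x)"
      using z unfolding omega_limit_def by blast
    have "agree k (translate t z) (translate (i + t) x)"
      unfolding agree_def
    proof
      fix j assume "j \<in> {- int k..int k}"
      then have "z (j + t) = translate i x (j + t)" by (intro agreeD[OF i(2)]) auto
      then show "translate t z j = translate (i + t) x j" by (simp add: translate_apply algebra_simps)
    qed
    moreover have "i + t \<ge> int N" using i(1) by simp
    ultimately show "\<exists>i\<ge>int N. agree k (translate t z) (translate i x)" by blast
  qed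
next
  fix z assume z: "\<And>k. \<exists>c\<in>omega_limit x. agree k z c"
  show "z \<in> omega_limit x"
    unfolding omega_limit_def
  proof (intro CollectI allI)
    fix k N
    obtain c where c: "c \<in> omega_limit x" "agree k z c" using z by blast
    then obtain i where "i \<ge> int N" "agree k c (translate i x)" unfolding omega_limit_def by blast
    with c(2) show "\<exists>i\<ge>int N. agree k z (translate i x)" by (blast intro: agree_trans)
  qed
qed

lemma image_omega_limit:
  assumes X: "shift_space X" and \<phi>: "code X Y \<phi>" and onto: "\<phi> ` X = Y"
    and x: "x \<in> X" and rt: "right_transitive Y (\<phi> x)"
  shows "\<phi> ` omega_limit x = Y"
proof
  show "\<phi> ` omega_limit x \<subseteq> Y"
    using subsystem_omega_limit[OF X x] onto unfolding subsystem_def by blast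
  show "Y \<subseteq> \<phi> ` omega_limit x"
  proof
    fix y assume y: "y \<in> Y"
    have "\<exists>i\<ge>int k. agree k (\<phi> (translate i x)) y" for k
    proof -
      obtain j where j: "j \<ge> int k" "block y (- int k) (2 * k + 1) = block (\<phi> x) j (2 * k + 1)"
      proof -
        have "\<forall>N::nat. \<exists>j\<ge>int N. occurs_at (block y (- int k) (2 * k + 1)) (\<phi> x) j"
          using rt block_in_language[OF y] unfolding right_transitive_iff by blast
        then show ?thesis using that unfolding occurs_at_iff_block length_block by blast
      qed
      have "agree k (translate (j + int k) (\<phi> x)) y"
        unfolding agree_def
      proof
        fix i assume i: "i \<in> {- int k..int k}"
        have "block y (- int k) (2 * k + 1) = block (translate (j + int k) (\<phi> x)) (- int k) (2 * k + 1)"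
          using j(2) by (simp add: block_translate)
        then show "translate (j + int k) (\<phi> x) i = y i"
          by (rule block_eqD[symmetric]) (use i in auto)
      qed
      then show ?thesis using j(1) by (intro exI[of _ "j + int k"]) (simp add: code_translate[OF X \<phi> x])
    qed
    then have "\<forall>k. \<exists>i. i \<ge> int k \<and> agree k (\<phi> (translate i x)) y" by blast
    from choice[OF this] obtain i where i: "\<And>k. i k \<ge> int k"
      "\<And>k. agree k (\<phi> (translate (i k) x)) y" by blast
    have s: "translate (i k) x \<in> X" for k by (rule shift_space_translate[OF X x])
    obtain z where z: "z \<in> X" "\<And>k N. \<exists>n\<ge>N. agree k z (translate (i n) x)"
      using cluster_point[of X "\<lambda>k. translate (i k) x", OF X s] by blast
    have "\<phi> z = y"
      by (rule code_cluster[OF X \<phi>, of "\<lambda>k. translate (i k) x", OF s i(2) z])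
    moreover have "z \<in> omega_limit x"
      unfolding omega_limit_def
    proof (intro CollectI allI)
      fix k N
      obtain n where n: "n \<ge> N" "agree k z (translate (i n) x)" using z(2) by blast
      then have "i n \<ge> int N" using i(1)[of n] by linarith
      with n(2) show "\<exists>i\<ge>int N. agree k z (translate i x)" by blast
    qed
    ultimately show "y \<in> \<phi> ` omega_limit x" by blast
  qed
qed

lemma right_transitiveI_omega_limit:
  assumes X: "shift_space X" and x: "x \<in> X" and eq: "omega_limit x = X"
  shows "right_transitive X x"
  unfolding right_transitive_iff
proof (intro conjI ballI allI)
  fix w N assume "w \<in> language X"
  then obtain z where z: "z \<in> X" "w = block z 0 (length w)" by (rule languageE[OF X])
  then obtain i where i: "i \<ge> int N" "agree (length w) z (translate i x)"
    using eq unfolding omega_limit_def by blast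
  have "w = block (translate i x) 0 (length w)"
    using agree_block[OF i(2), of 0 "length w"] z(2) by simp
  then show "\<exists>i\<ge>int N. occurs_at w x i"
    using i(1) by (auto simp: occurs_at_iff_block block_translate)
qed (rule x)

text \<open>The omega-limit set of \<open>x\<close> is a subsystem mapped onto \<open>Y\<close>. It is all of \<open>X\<close>, either because
  \<open>\<phi>\<close> is irreducible or because it has the entropy of \<open>Y\<close>, hence that of \<open>X\<close>.\<close>

lemma right_transitive_lift:
  assumes X: "shift_space X" and Y: "shift_space Y" and \<phi>: "code X Y \<phi>" and onto: "\<phi> ` X = Y"
    and fin: "finite_to_one X Y \<phi>"
    and min: "(\<forall>Z. subsystem Z X \<and> Z \<noteq> X \<longrightarrow> entropy Z < entropy X) \<or> irreducible_map X \<phi>"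
    and x: "x \<in> X" and rt: "right_transitive Y (\<phi> x)"
  shows "right_transitive X x"
proof (rule right_transitiveI_omega_limit[OF X x])
  let ?Z = "omega_limit x"
  have Z: "subsystem ?Z X" by (rule subsystem_omega_limit[OF X x])
  have img: "\<phi> ` ?Z = Y" by (rule image_omega_limit[OF X \<phi> onto x rt])
  have "entropy X \<le> entropy Y" by (rule finite_to_one_entropy_le[OF X Y \<phi> onto fin])
  also have "entropy Y \<le> entropy ?Z"
    using Z img by (intro factor_entropy_le[OF _ Y code_restrict[OF \<phi>]]) (auto simp: subsystem_def)
  finally have "\<not> entropy ?Z < entropy X" by simp
  with min Z img onto show "?Z = X"
    unfolding irreducible_map_def subsystem_iff[OF X] by metis
qed

section \<open>Shifts of finite type\<close>

text \<open>Once two points of \<open>Y\<close> agree on a window at least as long as all forbidden words, the left half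
  of one can be continued by the right half of the other.\<close>

lemma shift_of_finite_type_glue:
  assumes "shift_of_finite_type Y"
  shows "\<exists>m. \<forall>y\<in>Y. \<forall>z\<in>Y. \<forall>k. agree (k + m) y z \<longrightarrow> (\<lambda>i. if i \<le> int (k + m) then y i else z i) \<in> Y"
proof -
  obtain A F where F: "finite F" "Y = {x \<in> full_shift A. \<forall>w\<in>F. \<forall>i. \<not> occurs_at w x i}"
    using assms unfolding shift_of_finite_type_def by blast
  define m where "m = (\<Sum>w\<in>F. length w)"
  have m: "length w \<le> m" if "w \<in> F" for w
    unfolding m_def using F(1) that by (intro member_le_sum) auto
  have "(\<lambda>i. if i \<le> int (k + m) then y i else z i) \<in> Y"
    if y: "y \<in> Y" and z: "z \<in> Y" and a: "agree (k + m) y z" for y z k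
  proof -
    let ?x = "\<lambda>i. if i \<le> int (k + m) then y i else z i"
    have "?x \<in> full_shift A" using y z unfolding F(2) full_shift_def by auto
    moreover have "\<not> occurs_at w ?x i" if w: "w \<in> F" for w i
    proof
      assume occ: "occurs_at w ?x i"
      show False
      proof (cases "i \<ge> - int (k + m)")
        case True
        have "?x j = z j" if "j \<ge> i" for j
          using agreeD[OF a, of j] True that by auto
        then have "occurs_at w z i" using occ by (simp add: occurs_at_def)
        then show False using z w unfolding F(2) by blast
      next
        case False
        then have "occurs_at w y i" using occ m[OF w] by (auto simp: occurs_at_def)
        then show False using y w unfolding F(2) by blast
      qed
    qed
    ultimately show ?thesis unfolding F(2) by blast
  qed
  then show ?thesis by blast
qed

lemma shift_of_finite_type_imp_shift_space:
  assumes "shift_of_finite_type Y"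
  shows "shift_space Y"
proof -
  obtain A F where F: "finite A" "Y = {x \<in> full_shift A. \<forall>w\<in>F. \<forall>i. \<not> occurs_at w x i}"
    using assms unfolding shift_of_finite_type_def by blast
  have "translate t x \<in> Y" if "x \<in> Y" for t x
  proof -
    have "occurs_at w (translate t x) i \<longleftrightarrow> occurs_at w x (i + t)" for w i
      unfolding occurs_at_iff_block block_translate ..
    then show ?thesis using that unfolding F(2) by (auto simp: full_shift_def translate_def)
  qed
  then have "shift_map ` Y = Y" by (rule translate_invariant_image)
  moreover have "closedin (seq_top (full_shift A)) Y"
    unfolding closedin_seq_top
  proof (intro conjI ballI impI)
    fix x assume x: "x \<in> full_shift A" "\<forall>k. \<exists>c\<in>Y. agree k x c"
    have "\<not> occurs_at w x i" if w: "w \<in> F" for w i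
    proof
      assume "occurs_at w x i"
      obtain c where c: "c \<in> Y" "agree (nat \<bar>i\<bar> + length w) x c" using x(2) by blast
      have "block x i (length w) = block c i (length w)"
        by (rule agree_block[OF c(2)]) auto
      with \<open>occurs_at w x i\<close> have "occurs_at w c i" unfolding occurs_at_iff_block by simp
      with c(1) w show False unfolding F(2) by blast
    qed
    with x(1) show "x \<in> Y" unfolding F(2) by blast
  qed (auto simp: F(2))
  ultimately show ?thesis using F(1) unfolding shift_space_def by blast
qed

section \<open>Factors and tails of transitive points\<close>

lemma irreducible_factor:
  assumes X: "shift_space X" and irr: "irreducible_shift X" and \<phi>: "code X Y \<phi>" and onto: "\<phi> ` X = Y"
    and Y: "shift_space Y"
  shows "irreducible_shift Y"
  unfolding irreducible_shift_def
proof (intro ballI)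
  fix u v assume u: "u \<in> language Y" and v: "v \<in> language Y"
  obtain r where r: "\<And>k x x'. x \<in> X \<Longrightarrow> x' \<in> X \<Longrightarrow> agree (k + r) x x' \<Longrightarrow> agree k (\<phi> x) (\<phi> x')"
    using code_window[OF X \<phi>] by blast
  have lift: "\<exists>x\<in>X. w = block (\<phi> x) 0 (length w)" if w: "w \<in> language Y" for w
  proof -
    obtain y where "y \<in> Y" "w = block y 0 (length w)" by (rule languageE[OF Y w])
    then show ?thesis using onto by blast
  qed
  obtain x where x: "x \<in> X" "u = block (\<phi> x) 0 (length u)" using lift[OF u] by blast
  obtain x' where x': "x' \<in> X" "v = block (\<phi> x') 0 (length v)" using lift[OF v] by blast
  define a where "a = block x (- int (length u + r)) (2 * (length u + r) + 1)"
  define b where "b = block x' (- int (length v + r)) (2 * (length v + r) + 1)"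
  obtain g where "a @ g @ b \<in> language X"
    using irr x(1) x'(1) unfolding irreducible_shift_def a_def b_def by (meson block_in_language)
  then obtain z where z: "z \<in> X" "a @ g @ b = block z 0 (length (a @ g @ b))"
    by (rule languageE[OF X])
  have rec: "w = block (\<phi> z) (p + int (length w + r)) (length w)"
    if "x \<in> X" "w = block (\<phi> x) 0 (length w)"
      "block x (- int (length w + r)) (2 * (length w + r) + 1) = block z p (2 * (length w + r) + 1)"
    for w x p
  proof -
    let ?z = "translate (p + int (length w + r)) z"
    have "block x (- int (length w + r)) (2 * (length w + r) + 1) =
        block ?z (- int (length w + r)) (2 * (length w + r) + 1)"
      using that(3) by (simp add: block_translate)
    from block_eqD[OF this] have "agree (length w + r) x ?z" unfolding agree_def by auto
    then have "agree (length w) (\<phi> x) (\<phi> ?z)"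
      using that(1) shift_space_translate[OF X z(1)] by (intro r)
    then have "block (\<phi> x) 0 (length w) = block (\<phi> ?z) 0 (length w)" by (rule agree_block) auto
    then show ?thesis using that(2) by (simp add: code_translate[OF X \<phi> z(1)] block_translate)
  qed
  have ab: "a = block z 0 (length a)" "b = block z (int (length (a @ g))) (length b)"
    using append_eq_block[OF z(2)] append_eq_block(2)[of "a @ g" b z 0] z(2) by auto
  have lab: "length a = 2 * (length u + r) + 1" "length b = 2 * (length v + r) + 1"
    by (simp_all add: a_def b_def)
  define p where "p = length u + r"
  define q where "q = length (a @ g) + (length v + r)"
  have pu: "u = block (\<phi> z) (int p) (length u)"
    using rec[OF x, of 0] ab(1) lab by (simp add: a_def p_def)
  have "v = block (\<phi> z) (int (length (a @ g)) + int (length v + r)) (length v)"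
    by (rule rec[OF x']) (use ab(2)[unfolded lab(2)] in \<open>unfold b_def\<close>)
  then have qv: "v = block (\<phi> z) (int q) (length v)" unfolding q_def of_nat_add .
  have "p + length u \<le> q" unfolding p_def q_def by (simp add: lab)
  then have "block (\<phi> z) (int p) (length u + ((q - p - length u) + length v)) =
      u @ block (\<phi> z) (int p + int (length u)) (q - p - length u) @ v"
    unfolding block_append using pu qv by (simp add: of_nat_diff)
  moreover have "\<phi> z \<in> Y" using z(1) onto by blast
  ultimately show "\<exists>w. u @ w @ v \<in> language Y" by (metis block_in_language)
qed

lemma left_transitive_translate:
  assumes X: "shift_space X" and x: "left_transitive X x"
  shows "left_transitive X (translate t x)"
  unfolding left_transitive_iff
proof (intro conjI ballI allI)
  show "translate t x \<in> X" using x by (simp add: left_transitive_iff shift_space_translate[OF X])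
  fix w N assume "w \<in> language X"
  then obtain i where i: "i \<le> - int (N + nat \<bar>t\<bar>)" "occurs_at w x i"
    using x unfolding left_transitive_iff by blast
  then have "occurs_at w (translate t x) (i - t)"
    unfolding occurs_at_def translate_apply by (simp add: add.commute add.left_commute)
  with i(1) show "\<exists>i\<le>- int N. occurs_at w (translate t x) i" by (intro exI[of _ "i - t"] conjI) simp_all
qed

lemma right_transitive_translate:
  assumes X: "shift_space X" and x: "right_transitive X x"
  shows "right_transitive X (translate t x)"
  unfolding right_transitive_iff
proof (intro conjI ballI allI)
  show "translate t x \<in> X" using x by (simp add: right_transitive_iff shift_space_translate[OF X])
  fix w N assume "w \<in> language X"
  then obtain i where i: "i \<ge> int (N + nat \<bar>t\<bar>)" "occurs_at w x i"
    using x unfolding right_transitive_iff by blast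
  then have "occurs_at w (translate t x) (i - t)"
    unfolding occurs_at_def translate_apply by (simp add: add.commute add.left_commute)
  with i(1) show "\<exists>i\<ge>int N. occurs_at w (translate t x) i" by (intro exI[of _ "i - t"] conjI) simp_all
qed

lemma right_transitive_eventually:
  assumes x: "right_transitive X x" and z: "z \<in> X" "\<And>i. i \<ge> a \<Longrightarrow> z i = x i"
  shows "right_transitive X z"
  unfolding right_transitive_iff
proof (intro conjI ballI allI)
  fix w N assume "w \<in> language X"
  then obtain i where i: "i \<ge> int (N + nat \<bar>a\<bar>)" "occurs_at w x i"
    using x unfolding right_transitive_iff by blast
  then have "occurs_at w z i" using z(2) by (simp add: occurs_at_def)
  with i(1) show "\<exists>i\<ge>int N. occurs_at w z i" by (intro exI[of _ i]) auto
qed (rule z)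

section \<open>Lifting\<close>

text \<open>The retract condition, with the coordinate \<open>0\<close> moved to \<open>k\<close>.\<close>

lemma right_retract_at:
  assumes X: "shift_space X" and Y: "shift_space Y" and \<phi>: "code X Y \<phi>"
    and ret: "right_continuing_ae_retract X Y \<phi> n"
    and x: "left_transitive X x" and y: "y \<in> Y" "\<And>i. i \<le> k \<Longrightarrow> \<phi> x i = y i"
  shows "\<exists>x'\<in>X. \<phi> x' = y \<and> (\<forall>i\<le>k - int n. x' i = x i)"
proof -
  have xX: "x \<in> X" using x by (simp add: left_transitive_def)
  have "\<forall>i\<le>0. \<phi> (translate k x) i = translate k y i"
    using y(2) by (simp add: code_translate[OF X \<phi> xX] translate_apply)
  then obtain x' where x': "x' \<in> X" "\<phi> x' = translate k y" "\<And>i. i \<le> - int n \<Longrightarrow> x' i = translate k x i"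
    using ret[unfolded right_continuing_ae_retract_def, rule_format,
        of "translate k x" "translate k y"]
      left_transitive_translate[OF X x, of k] shift_space_translate[OF Y y(1), of k]
    by blast
  have "\<phi> (translate (- k) x') = y" using x'(1,2) by (simp add: code_translate[OF X \<phi>])
  moreover have "translate (- k) x' i = x i" if "i \<le> k - int n" for i
    using x'(3)[of "i - k"] that by (simp add: translate_apply)
  ultimately show ?thesis using shift_space_translate[OF X x'(1)] by blast
qed

lemma left_retract_at:
  assumes X: "shift_space X" and Y: "shift_space Y" and \<phi>: "code X Y \<phi>"
    and ret: "left_continuing_ae_retract X Y \<phi> n"
    and x: "right_transitive X x" and y: "y \<in> Y" "\<And>i. i \<ge> k \<Longrightarrow> \<phi> x i = y i"
  shows "\<exists>x'\<in>X. \<phi> x' = y \<and> (\<forall>i\<ge>k + int n. x' i = x i)"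
proof -
  have xX: "x \<in> X" using x by (simp add: right_transitive_def)
  have "\<forall>i\<ge>0. \<phi> (translate k x) i = translate k y i"
    using y(2) by (simp add: code_translate[OF X \<phi> xX] translate_apply)
  then obtain x' where x': "x' \<in> X" "\<phi> x' = translate k y" "\<And>i. i \<ge> int n \<Longrightarrow> x' i = translate k x i"
    using ret[unfolded left_continuing_ae_retract_def, rule_format,
        of "translate k x" "translate k y"]
      right_transitive_translate[OF X x, of k] shift_space_translate[OF Y y(1), of k]
    by blast
  have "\<phi> (translate (- k) x') = y" using x'(1,2) by (simp add: code_translate[OF X \<phi>])
  moreover have "translate (- k) x' i = x i" if "i \<ge> k + int n" for i
    using x'(3)[of "i - k"] that by (simp add: translate_apply)
  ultimately show ?thesis using shift_space_translate[OF X x'(1)] by blast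
qed

text \<open>The heart of the argument. The glued point follows \<open>\<phi> x\<close> on the left and \<open>y\<close> on the right.
  Its lift \<open>x1\<close> obtained from the right retract is right transitive, because its image has the
  right tail of \<open>y\<close>. So the left retract applies to \<open>x1\<close>, and each of the two steps costs \<open>n\<close>
  coordinates at one end of the window.\<close>

lemma lift_transitive_pair:
  assumes X: "shift_space X" and Y: "shift_space Y" and \<phi>: "code X Y \<phi>"
    and lift_rt: "\<And>x. x \<in> X \<Longrightarrow> right_transitive Y (\<phi> x) \<Longrightarrow> right_transitive X x"
    and right: "right_continuing_ae_retract X Y \<phi> n" and left: "left_continuing_ae_retract X Y \<phi> n"
    and glue: "(\<lambda>i. if i \<le> int k then \<phi> x i else y i) \<in> Y"
    and x: "left_transitive X x" and y: "right_transitive Y y" and a: "agree k (\<phi> x) y"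
    and l: "l + n \<le> k"
  shows "\<exists>x'\<in>X. agree l x x' \<and> \<phi> x' = y"
proof -
  let ?z = "\<lambda>i. if i \<le> int k then \<phi> x i else y i"
  have zy: "?z i = y i" if "i \<ge> - int k" for i using agreeD[OF a, of i] that by auto
  obtain x1 where x1: "x1 \<in> X" "\<phi> x1 = ?z" "\<And>i. i \<le> int k - int n \<Longrightarrow> x1 i = x i"
    using right_retract_at[OF X Y \<phi> right x glue, of "int k"] by auto
  have "right_transitive Y ?z" using y glue zy by (rule right_transitive_eventually)
  then have "right_transitive X x1" using x1(1,2) by (intro lift_rt) simp_all
  moreover have "y \<in> Y" using y by (simp add: right_transitive_def)
  moreover have "\<phi> x1 i = y i" if "i \<ge> - int k" for i using zy[OF that] x1(2) by simp
  ultimately obtain x' where x': "x' \<in> X" "\<phi> x' = y" "\<And>i. i \<ge> - int k + int n \<Longrightarrow> x' i = x1 i"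
    using left_retract_at[OF X Y \<phi> left] by metis
  have "agree l x x'" unfolding agree_def using x1(3) x'(3) l by simp
  with x' show ?thesis by blast
qed

text \<open>The same \<open>k\<close> serves for all points if it serves for dense sets of \<open>x\<close> and \<open>y\<close>: a cluster
  point of lifts of approximating pairs is a lift.\<close>

lemma lifting_length_by_density:
  assumes X: "shift_space X" and Y: "shift_space Y" and \<phi>: "code X Y \<phi>"
    and P: "\<And>x k. x \<in> X \<Longrightarrow> \<exists>x'\<in>X. P x' \<and> agree k x x'"
    and Q: "\<And>y k. y \<in> Y \<Longrightarrow> \<exists>y'\<in>Y. Q y' \<and> agree k y y'"
    and lift: "\<And>x y. x \<in> X \<Longrightarrow> y \<in> Y \<Longrightarrow> P x \<Longrightarrow> Q y \<Longrightarrow> agree k (\<phi> x) y \<Longrightarrow> \<exists>x'\<in>X. agree l x x' \<and> \<phi> x' = y"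
  shows "lifting_length X Y \<phi> l k"
  unfolding lifting_length_def
proof (intro ballI impI)
  fix x y assume x: "x \<in> X" and y: "y \<in> Y" and "\<forall>i\<in>{- int k..int k}. \<phi> x i = y i"
  then have a: "agree k (\<phi> x) y" by (simp add: agree_def)
  obtain r where r: "\<And>k x x'. x \<in> X \<Longrightarrow> x' \<in> X \<Longrightarrow> agree (k + r) x x' \<Longrightarrow> agree k (\<phi> x) (\<phi> x')"
    using code_window[OF X \<phi>] by blast
  \<comment> \<open>The approximating pairs may be chosen independently of each other: near \<open>x\<close> and \<open>y\<close> the
    agreement on \<open>[- k, k]\<close> persists.\<close>
  have "\<exists>x'. x' \<in> X \<and> agree l x x' \<and> agree j (\<phi> x') y" for j
  proof -
    obtain u where u: "u \<in> X" "P u" "agree (k + r + l) x u" using P[OF x] by blast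
    obtain v where v: "v \<in> Y" "Q v" "agree (k + j) y v" using Q[OF y] by blast
    have "agree k (\<phi> x) (\<phi> u)" using x u(1) agree_mono[OF u(3)] by (intro r) simp_all
    then have "agree k (\<phi> u) y" using a agree_sym agree_trans by blast
    then have "agree k (\<phi> u) v" using agree_mono[OF v(3), of k] agree_trans by auto
    then obtain x' where "x' \<in> X" "agree l u x'" "\<phi> x' = v" using lift u v by blast
    moreover have "agree l x u" using agree_mono[OF u(3)] by simp
    moreover have "agree j v y" by (rule agree_sym, rule agree_mono[OF v(3)]) simp
    ultimately show ?thesis by (blast intro: agree_trans)
  qed
  then have "\<forall>j. \<exists>x'. x' \<in> X \<and> agree l x x' \<and> agree j (\<phi> x') y" by blast
  from choice[OF this] obtain s where s: "\<And>j. s j \<in> X" "\<And>j. agree l x (s j)" "\<And>j. agree j (\<phi> (s j)) y"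
    by blast
  obtain x' where x': "x' \<in> X" "\<And>k N. \<exists>n\<ge>N. agree k x' (s n)"
    using cluster_point[of X s, OF X s(1)] by blast
  have "\<phi> x' = y" by (rule code_cluster[OF X \<phi> s(1,3) x'])
  moreover obtain j where "agree l x' (s j)" using x'(2) by blast
  then have "agree l x' x" using s(2) agree_sym agree_trans by blast
  ultimately show "\<exists>x'\<in>X. (\<forall>i\<in>{- int l..int l}. x' i = x i) \<and> \<phi> x' = y"
    using x'(1) by (auto simp: agree_def)
qed

lemma open_map_of_lifting_length:
  assumes onto: "\<phi> ` X = Y" and lift: "\<And>l. lifting_length X Y \<phi> l (k l)"
  shows "open_map (seq_top X) (seq_top Y) \<phi>"
  unfolding open_map_def
proof (intro allI impI)
  fix U assume U: "openin (seq_top X) U"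
  show "openin (seq_top Y) (\<phi> ` U)"
    unfolding openin_seq_top
  proof (intro conjI ballI)
    show "\<phi> ` U \<subseteq> Y" using U onto unfolding openin_seq_top by blast
    fix y assume "y \<in> \<phi> ` U"
    then obtain x where x: "x \<in> U" "y = \<phi> x" by blast
    have xX: "x \<in> X" using x(1) U unfolding openin_seq_top by blast
    obtain l where l: "\<And>x'. x' \<in> X \<Longrightarrow> agree l x x' \<Longrightarrow> x' \<in> U"
      using U x(1) unfolding openin_seq_top by blast
    have "y' \<in> \<phi> ` U" if y': "y' \<in> Y" "agree (k l) y y'" for y'
    proof -
      have "\<forall>i\<in>{- int (k l)..int (k l)}. \<phi> x i = y' i" using y'(2) x(2) by (simp add: agree_def)
      then obtain x' where x': "x' \<in> X" "\<forall>i\<in>{- int l..int l}. x' i = x i" "\<phi> x' = y'"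
        using lift[of l] xX y'(1) unfolding lifting_length_def by blast
      then have "agree l x x'" by (simp add: agree_def)
      with l x' show ?thesis by blast
    qed
    then show "\<exists>k. \<forall>y'\<in>Y. agree k y y' \<longrightarrow> y' \<in> \<phi> ` U" by blast
  qed
qed

theorem theorem4p13:
  fixes X :: "(int \<Rightarrow> 'a) set" and Y :: "(int \<Rightarrow> 'b) set"
    and \<phi> :: "(int \<Rightarrow> 'a) \<Rightarrow> int \<Rightarrow> 'b"
  assumes "shift_space X"
    and "shift_of_finite_type Y"
    and "factor_code X Y \<phi>"
    and "finite_to_one X Y \<phi>"
    and "(\<forall>Z. subsystem Z X \<and> Z \<noteq> X \<longrightarrow> entropy Z < entropy X) \<or>
         (irreducible_shift X \<and> irreducible_map X \<phi>)"
    and "bi_continuing_ae_with_bi_retract X Y \<phi>"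
  shows "open_with_uniform_lifting_length X Y \<phi>"
proof -
  note X = assms(1)
  have Y: "shift_space Y" using assms(2) by (rule shift_of_finite_type_imp_shift_space)
  have \<phi>: "code X Y \<phi>" and onto: "\<phi> ` X = Y" using assms(3) by (simp_all add: factor_code_def)
  have irrX: "irreducible_shift X"
    using assms(5) entropy_minimal_imp_irreducible[OF X] by blast
  have irrY: "irreducible_shift Y" by (rule irreducible_factor[OF X irrX \<phi> onto Y])
  have rt: "right_transitive X x" if "x \<in> X" "right_transitive Y (\<phi> x)" for x
    using right_transitive_lift[OF X Y \<phi> onto assms(4) _ that] assms(5) by blast
  obtain n where right: "right_continuing_ae_retract X Y \<phi> n" and left: "left_continuing_ae_retract X Y \<phi> n"
    using assms(6) unfolding bi_continuing_ae_with_bi_retract_def by blast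
  obtain m where m: "\<And>y z k. y \<in> Y \<Longrightarrow> z \<in> Y \<Longrightarrow> agree (k + m) y z \<Longrightarrow>
      (\<lambda>i. if i \<le> int (k + m) then y i else z i) \<in> Y"
    using shift_of_finite_type_glue[OF assms(2)] by blast
  have lift: "lifting_length X Y \<phi> l (l + n + m)" for l
  proof (rule lifting_length_by_density[OF X Y \<phi>])
    show "\<exists>x'\<in>X. left_transitive X x' \<and> agree k x x'" if "x \<in> X" for x k
      using dense_left_transitive[OF X irrX that] unfolding left_transitive_def by blast
    show "\<exists>y'\<in>Y. right_transitive Y y' \<and> agree k y y'" if "y \<in> Y" for y k
      using dense_right_transitive[OF Y irrY that] unfolding right_transitive_def by blast
    fix x y assume x: "x \<in> X" "left_transitive X x" and y: "y \<in> Y" "right_transitive Y y"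
      and a: "agree (l + n + m) (\<phi> x) y"
    have "\<phi> x \<in> Y" using x(1) onto by blast
    note glue = m[OF this y(1) a]
    show "\<exists>x'\<in>X. agree l x x' \<and> \<phi> x' = y"
      by (rule lift_transitive_pair[OF X Y \<phi> _ right left glue x(2) y(2) a]) (auto intro: rt)
  qed
  have "open_map (seq_top X) (seq_top Y) \<phi>" by (rule open_map_of_lifting_length[OF onto lift])
  moreover have "bdd_above (range (\<lambda>l. \<bar>int (l + n + m) - int l\<bar>))"
    by (intro bdd_aboveI[of _ "int (n + m)"]) auto
  ultimately show ?thesis
    unfolding open_with_uniform_lifting_length_def using lift
    by (intro conjI exI[of _ "\<lambda>l. l + n + m"] allI)
qed

end
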